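(* Let $K$ be a symmetric convex body in $\mathbb{R}^n$ and let $x$ be a normal point of $\partial K$, with outer unit normal $N(x)$. Let $\tau>0$ and, for $h>0$ small enough, let $x_h$ be the point of the form $\lambda x$ with $\lambda>0$ such that $K\cap(x_h+\tau K)$ has width $h$ in the direction $N(x)$. Then the Gauss–Kronecker curvature $\kappa(x)$ of $\partial K$ at $x$ is given by $$\kappa(x)=\lim_{h\to0}\frac{c_n^{\,n+1}\,h^{n+1}}{\left(\frac{1+\tau}{\tau}\right)^{n-1}|K\cap(x_h+\tau K)|^2},$$ where $c_n=2\left(\frac{\omega_{n-1}}{n+1}\right)^{\frac{2}{n+1}}$ and $\omega_k$ is the volume of the $k$-dimensional Euclidean unit ball.
   Context: A convex body in $\mathbb{R}^n$ is a compact convex set with non-empty interior; symmetric means $K=-K$. $|A|$ is the $n$-dimensional Lebesgue measure of $A$. The width of a compact set $A$ in the direction of a unit vector $u$ is $\max_{a\in A}\langle a,u\rangle-\min_{a\in A}\langle a,u\rangle$. A point $x\in\partial K$ is a normal point if $K$ has a unique outer unit normal $N(x)$ at $x$ and the Dupin indicatrix of $K$ at $x$ exists: letting $H_h$ be the hyperplane orthogonal to $N(x)$ that meets $K$ at distance $h>0$ from the tangent hyperplane at $x$, the sets $\frac{1}{\sqrt{2h}}\,P(K\cap H_h-x)$, where $P$ is the orthogonal projection onto $N(x)^\perp$, converge as $h\to0^+$ to a set $\{y\in N(x)^\perp: q(y)\le1\}$ with $q$ a positive semidefinite quadratic form (an ellipsoid, or a cylinder over one with some infinite semi-axes; in the latter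 case convergence is understood locally). Equivalently, near $x$ the boundary of $K$ is the set of points $x+y-f(y)N(x)$, $y\in N(x)^\perp$ small, where $f$ is convex with $f(y)=\frac12 q(y)+o(|y|^2)$. The principal curvatures at $x$ are the reciprocal squares of the semi-axes of the indicatrix (the eigenvalues of $q$, with $0$ for an infinite semi-axis), and $\kappa(x)$ is their product. *)

theory Defs
  imports "HOL-Analysis.Analysis"
begin

definition symmetric_convex_body :: "'a::euclidean_space set \<Rightarrow> bool" where
  "symmetric_convex_body K \<longleftrightarrow>
     compact K \<and> convex K \<and> interior K \<noteq> {} \<and> uminus ` K = K"

text \<open>For a nonempty compact set the supremum and infimum are attained; the value on the
  empty set is junk.\<close>

definition width :: "'a::euclidean_space \<Rightarrow> 'a set \<Rightarrow> real" where
  "width u A = (SUP a\<in>A. a \<bullet> u) - (INF a\<in>A. a \<bullet> u)"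

definition outer_unit_normal :: "'a::euclidean_space set \<Rightarrow> 'a \<Rightarrow> 'a \<Rightarrow> bool" where
  "outer_unit_normal K x u \<longleftrightarrow> norm u = 1 \<and> (\<forall>y\<in>K. (y - x) \<bullet> u \<le> 0)"

text \<open>The set of all \<open>P (y - x) / sqrt (2 h)\<close>, where \<open>P\<close> is the orthogonal projection along
  \<open>u\<close> and \<open>y\<close> ranges over the points of \<open>K\<close> at depth \<open>h\<close> below the hyperplane through \<open>x\<close>
  orthogonal to \<open>u\<close>.\<close>

definition scaled_section ::
    "'a::euclidean_space set \<Rightarrow> 'a \<Rightarrow> 'a \<Rightarrow> real \<Rightarrow> 'a set" where
  "scaled_section K x u h =
     (\<lambda>y. (1 / sqrt (2 * h)) *\<^sub>R ((y - x) - ((y - x) \<bullet> u) *\<^sub>R u))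
       ` (K \<inter> {y. y \<bullet> u = x \<bullet> u - h})"

text \<open>Hausdorff convergence of sets, localised to balls.  For convex sets converging to a
  bounded nonempty set this coincides with convergence in the Hausdorff metric; the localisation
  only matters for unbounded limits (elliptic cylinders).\<close>

definition converges_locally ::
    "('b \<Rightarrow> 'a::euclidean_space set) \<Rightarrow> 'a set \<Rightarrow> 'b filter \<Rightarrow> bool" where
  "converges_locally A L F \<longleftrightarrow>
     (\<forall>R>0. \<forall>e>0. \<forall>\<^sub>F h in F.
        (\<forall>y\<in>A h \<inter> cball 0 R. \<exists>z\<in>L. dist y z < e) \<and>
        (\<forall>z\<in>L \<inter> cball 0 R. \<exists>y\<in>A h. dist y z < e))"

text \<open>Only the values of \<open>q\<close> on the subspace \<open>S\<close> matter in the following notions.  Every bilinear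
  form on \<open>S\<close> extends to the whole space, and it need not be taken symmetric.\<close>

definition psd_quadratic_form_on ::
    "'a::euclidean_space set \<Rightarrow> ('a \<Rightarrow> real) \<Rightarrow> bool" where
  "psd_quadratic_form_on S q \<longleftrightarrow>
     (\<exists>B :: 'a \<Rightarrow> 'a \<Rightarrow> real. bilinear B \<and> (\<forall>y\<in>S. q y = B y y)) \<and> (\<forall>y\<in>S. 0 \<le> q y)"

text \<open>Eigenvectors (and \<open>0\<close>) of the self-adjoint operator on \<open>S\<close> representing \<open>q\<close>; the left-hand
  side is the symmetric bilinear form recovered from \<open>q\<close> by polarisation.\<close>

definition form_eigenspace ::
    "'a::euclidean_space set \<Rightarrow> ('a \<Rightarrow> real) \<Rightarrow> real \<Rightarrow> 'a set" where
  "form_eigenspace S q \<mu> =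
     {v\<in>S. \<forall>w\<in>S. (q (v + w) - q v - q w) / 2 = \<mu> * (v \<bullet> w)}"

text \<open>The product of the eigenvalues, counted with multiplicity (\<open>1\<close> if \<open>S\<close> is trivial).\<close>

definition eigenvalue_product ::
    "'a::euclidean_space set \<Rightarrow> ('a \<Rightarrow> real) \<Rightarrow> real" where
  "eigenvalue_product S q =
     (\<Prod>\<mu> | form_eigenspace S q \<mu> \<noteq> {0}. \<mu> ^ dim (form_eigenspace S q \<mu>))"

definition dupin_indicatrix_form ::
    "'a::euclidean_space set \<Rightarrow> 'a \<Rightarrow> 'a \<Rightarrow> ('a \<Rightarrow> real) \<Rightarrow> bool" where
  "dupin_indicatrix_form K x u q \<longleftrightarrow>
     psd_quadratic_form_on ({u}\<^sup>\<bottom>) q \<and>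
     converges_locally (scaled_section K x u) {y \<in> {u}\<^sup>\<bottom>. q y \<le> 1} (at_right 0)"

definition normal_point :: "'a::euclidean_space set \<Rightarrow> 'a \<Rightarrow> bool" where
  "normal_point K x \<longleftrightarrow>
     x \<in> frontier K \<and>
     (\<exists>!u. outer_unit_normal K x u) \<and>
     (\<exists>u q. outer_unit_normal K x u \<and> dupin_indicatrix_form K x u q)"

text \<open>At a normal point, \<open>u\<close> is unique and \<open>q\<close> is unique on the orthogonal complement of \<open>u\<close>,
  since the limit set is closed and determines \<open>q\<close> there.\<close>

definition gauss_kronecker_curvature :: "'a::euclidean_space set \<Rightarrow> 'a \<Rightarrow> real" where
  "gauss_kronecker_curvature K x =
     (THE c. \<exists>u q. outer_unit_normal K x u \<and> dupin_indicatrix_form K x u q \<and>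
               c = eigenvalue_product ({u}\<^sup>\<bottom>) q)"

definition lens :: "'a::euclidean_space set \<Rightarrow> real \<Rightarrow> 'a \<Rightarrow> 'a set" where
  "lens K \<tau> p = K \<inter> (\<lambda>a. p + \<tau> *\<^sub>R a) ` K"

definition is_lens_centre ::
    "'a::euclidean_space set \<Rightarrow> 'a \<Rightarrow> 'a \<Rightarrow> real \<Rightarrow> real \<Rightarrow> 'a \<Rightarrow> bool" where
  "is_lens_centre K x u \<tau> h p \<longleftrightarrow>
     (\<exists>l>0. p = l *\<^sub>R x) \<and> lens K \<tau> p \<noteq> {} \<and> width u (lens K \<tau> p) = h"

definition lens_centre ::
    "'a::euclidean_space set \<Rightarrow> 'a \<Rightarrow> 'a \<Rightarrow> real \<Rightarrow> real \<Rightarrow> 'a" where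
  "lens_centre K x u \<tau> h = (THE p. is_lens_centre K x u \<tau> h p)"

definition lens_const :: "nat \<Rightarrow> real" where
  "lens_const n =
     2 * (unit_ball_vol (real (n - 1)) / (real n + 1)) powr (2 / (real n + 1))"

end

theory Submission
  imports Defs
begin

text \<open>
  Write a point as \<open>x - (t / s) x + w\<close> with \<open>s = x \<bullet> N\<close> and \<open>w\<close> orthogonal to \<open>N\<close>, that is,
  project along \<open>x\<close> rather than along \<open>N\<close>. Since \<open>K = -K\<close>, the point lies in
  \<open>K \<inter> (x\<^sub>h + \<tau> K)\<close> iff both it and \<open>x - (t' / s) x - w / \<tau>\<close> with \<open>t' = (h - t) / \<tau>\<close> lie in \<open>K\<close>.
  Near \<open>x\<close> the body is squeezed between the paraboloids \<open>q w + \<epsilon> \<bar>w\<bar>\<^sup>2 \<le> 2 t\<close> and, if \<open>q\<close> is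
  positive definite, \<open>(1 - \<epsilon>) q w \<le> 2 t\<close>. So the lens is squeezed between intersections of two
  opposite paraboloids, which are affine images of one fixed set; its volume is computed by slicing.
  If \<open>q\<close> is degenerate, the curvature is \<open>0\<close> and the inner paraboloid alone suffices.
  The same limit for every admissible \<open>q\<close> also shows that the curvature is well defined.
\<close>

section \<open>Linear images over finite index types\<close>

text \<open>The quotient is exact on the models: for opposite paraboloids with eigenvalues \<nu>_b
  and depth h the volume is a * h^((n+1)/2) / sqrt (prod \<nu>_b), so the quotient equals prod
  \<nu>_b for every h and the squeeze only has to perturb eigenvalues. The obstacle is that the
  Dupin indicatrix controls sections only up to a Hausdorff error and only in balls, while the
  squeeze needs true inclusions. Convexity supplies them. From inside: a closed convex set that
  comes within r of every point of a ball of radius r contains its centre. From outside: a point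
  violating the bound is pulled towards the axis until it lands on a compact ellipsoid, where local
  convergence applies. The additive \<epsilon> keeps the inner cross-sections bounded even if q is
  degenerate; the outer factor 1 - \<epsilon> does so only for positive definite q, and otherwise
  the lower bound is just nonnegativity of the quotient. A limit from the right says nothing about
  depth 0, which gets its own argument on both sides.\<close>

lemma measure_shear_cbox:
  fixes a b :: "real^'n"
  assumes "m \<noteq> n"
  shows "measure lebesgue ((\<lambda>x. \<chi> i. if i = m then x$m + x$n else x$i) ` cbox a b) =
    measure lebesgue (cbox a b)"
proof (cases "cbox a b = {}")
  case False
  let ?f = "\<lambda>x::real^'n. \<chi> i. if i = m then x$m + x$n else x$i"
  \<comment> \<open>The shear formula for boxes wants coordinate \<open>n\<close> to be nonnegative.
    Translating by \<open>c\<close> moves that face of the box to 0, and additivity of the shear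
    turns this translation into another translation.\<close>
  define c where "c = (\<chi> i. if i = n then a$n else (0::real))"
  have f_add: "?f (c + x) = ?f c + ?f x" for x
    by (auto simp: vec_eq_iff algebra_simps)
  have box: "cbox a b = (+) c ` cbox (a - c) (b - c)"
    using cbox_translation[of c "a - c" "b - c"] by simp
  then have "?f ` cbox a b = (+) (?f c) ` ?f ` cbox (a - c) (b - c)"
    by (simp add: image_image f_add)
  then have "measure lebesgue (?f ` cbox a b) = measure lebesgue (?f ` cbox (a - c) (b - c))"
    by (simp add: measure_translation)
  also have "\<dots> = measure lebesgue (cbox (a - c) (b - c))"
    using False box by (intro measure_shear_interval assms) (auto simp: c_def)
  also have "\<dots> = measure lebesgue (cbox a b)"
    by (simp add: box measure_translation)
  finally show ?thesis .
qed simp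

 lemma cbox_swap_coordinates:
  fixes a b :: "real^'n" and m n :: 'n
  defines "h \<equiv> \<lambda>v::real^'n. \<chi> i. v $ Transposition.transpose m n i"
  shows "h ` cbox a b = cbox (h a) (h b)"
proof (rule set_eqI)
  fix v
  have hh: "h (h w) = w" for w
    by (simp add: h_def vec_eq_iff)
  have "w \<in> cbox (h a) (h b) \<longleftrightarrow> h w \<in> cbox a b" for w
    unfolding h_def mem_box_cart vec_lambda_beta by (metis transpose_involutory)
  moreover have "v \<in> h ` cbox a b \<longleftrightarrow> h v \<in> cbox a b"
    using hh by (metis image_eqI imageE)
  ultimately show "v \<in> h ` cbox a b \<longleftrightarrow> v \<in> cbox (h a) (h b)"
    by blast
qed

text \<open>The library version, \<open>measure_linear_image\<close>, is restricted to well-ordered index types.\<close>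

lemma linear_image_finite_cart:
  fixes f :: "real^'n \<Rightarrow> real^'n"
  assumes "linear f" "S \<in> lmeasurable"
  shows "f ` S \<in> lmeasurable \<and> measure lebesgue (f ` S) = \<bar>det (matrix f)\<bar> * measure lebesgue S"
proof -
  define P where "P f \<longleftrightarrow> (\<forall>S\<in>lmeasurable. f ` S \<in> lmeasurable \<and>
    measure lebesgue (f ` S) = \<bar>det (matrix f)\<bar> * measure lebesgue S)" for f :: "real^'n \<Rightarrow> real^'n"
  \<comment> \<open>For maps with determinant of modulus 1 it suffices to compare measures on boxes;
    the coordinate swap and the shear are treated this way.\<close>
  have box: "P f" if "linear f" "\<bar>det (matrix f)\<bar> = 1"
    "\<And>a b. measure lebesgue (f ` cbox a b) = measure lebesgue (cbox a b)" for f :: "real^'n \<Rightarrow> real^'n"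
    unfolding P_def
  proof
    fix S :: "(real^'n) set" assume "S \<in> lmeasurable"
    from measure_linear_sufficient[OF that(1) this, of 1] that(2,3)
    show "f ` S \<in> lmeasurable \<and> measure lebesgue (f ` S) = \<bar>det (matrix f)\<bar> * measure lebesgue S"
      by simp
  qed
  have "P f"
  proof (rule induct_linear_elementary[OF \<open>linear f\<close>])
    show "P (f \<circ> g)" if "linear f" "linear g" "P f" "P g" for f g
    proof -
      have "(f \<circ> g) ` S = f ` g ` S" for S
        by (rule image_comp[symmetric])
      then show ?thesis
        using that(3,4) matrix_compose[OF that(2,1)] unfolding P_def
        by (metis (no_types, lifting) abs_mult det_mul mult.assoc)
    qed
  next
    fix f :: "real^'n \<Rightarrow> real^'n" and i
    assume f: "linear f" "\<And>x. f x $ i = 0"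
    then have "axis i 1 \<notin> range f"
      by (metis axis_nth imageE one_neq_zero)
    then have "\<not> inj f"
      using linear_injective_imp_surjective[OF f(1)] by blast
    then have "negligible (f ` S)" for S
      by (rule negligible_linear_singular_image[OF f(1)])
    moreover have "det (matrix f) = 0"
      using \<open>\<not> inj f\<close> det_nz_iff_inj[OF f(1)] by blast
    ultimately show "P f"
      by (auto simp: P_def negligible_imp_measure0 negligible_imp_measurable)
  next
    show "P (\<lambda>x. \<chi> i. c i * x $ i)" for c :: "'n \<Rightarrow> real"
    proof -
      have "matrix (\<lambda>x::real^'n. \<chi> i. c i * x $ i) = (\<chi> i j. if i = j then c i else 0)"
        by (simp add: matrix_def axis_def vec_eq_iff)
      then have "det (matrix (\<lambda>x::real^'n. \<chi> i. c i * x $ i)) = prod c UNIV"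
        by (simp add: det_diagonal)
      then show ?thesis
        by (simp add: P_def measurable_stretch measure_stretch)
    qed
  next
    fix m n :: 'n assume "m \<noteq> n"
    let ?h = "\<lambda>v::real^'n. \<chi> i. v $ Transposition.transpose m n i"
    show "P ?h"
    proof (rule box)
      show "linear ?h"
        by (rule linearI) (simp_all add: vec_eq_iff)
      have "matrix ?h = (\<chi> i. mat 1 $ Transposition.transpose m n i)"
        by (simp add: matrix_def axis_def mat_def vec_eq_iff)
      then show "\<bar>det (matrix ?h)\<bar> = 1"
        using \<open>m \<noteq> n\<close> by (simp add: det_permute_rows permutes_swap_id sign_swap_id)
      fix a b :: "real^'n"
      have ne: "cbox (?h a) (?h b) = {} \<longleftrightarrow> cbox a b = {}"
        by (metis cbox_swap_coordinates image_is_empty)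
      show "measure lebesgue (?h ` cbox a b) = measure lebesgue (cbox a b)"
        unfolding cbox_swap_coordinates
        using ne prod.permute[OF permutes_swap_id[of m UNIV n], where g="\<lambda>i. (b - a)$i"]
        by (cases "cbox a b = {}") (auto simp: content_cbox_cart o_def)
    qed
  next
    fix m n :: 'n assume mn: "m \<noteq> n"
    let ?h = "\<lambda>v::real^'n. \<chi> i. if i = m then v $ m + v $ n else v $ i"
    show "P ?h"
    proof (rule box)
      show "linear ?h"
        by (rule linearI) (auto simp: vec_eq_iff algebra_simps)
      have "matrix ?h = (\<chi> k. if k = m then row m (mat 1) + 1 *s row n (mat 1) else row k (mat 1))"
        using mn by (auto simp: matrix_def axis_def mat_def row_def vec_eq_iff)
      then show "\<bar>det (matrix ?h)\<bar> = 1"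
        using det_row_operation[OF mn, of "mat 1 :: real^'n^'n" 1] by simp
    qed (rule measure_shear_cbox[OF mn])
  qed
  with assms show ?thesis
    by (simp add: P_def)
qed

section \<open>Orthonormal eigenbases\<close>

text \<open>Spectral theorem by induction on the dimension: a maximiser of \<open>G v v\<close> on
  the unit sphere of \<open>S\<close> is an eigenvector, and the induction continues in its
  orthogonal complement inside \<open>S\<close>. As the basis vectors are unit vectors, the
  eigenvalue of \<open>b\<close> is \<open>G b b\<close>, so no operator has to be
  introduced.\<close>

lemma orthonormal_eigenbasis:
  fixes G :: "'a::euclidean_space \<Rightarrow> 'a \<Rightarrow> real"
  assumes G: "bilinear G" and sym: "\<And>v w. G v w = G w v" and "subspace S"
  shows "\<exists>B. finite B \<and> pairwise orthogonal B \<and> (\<forall>b\<in>B. norm b = 1) \<and> span B = S \<and>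
    (\<forall>b\<in>B. \<forall>w\<in>S. G b w = G b b * (b \<bullet> w))"
  using \<open>subspace S\<close>
proof (induction "dim S" arbitrary: S rule: less_induct)
  case less
  note S = \<open>subspace S\<close>
  show ?case
  proof (cases "S = {0}")
    case True
    then show ?thesis
      by (intro exI[of _ "{}"]) auto
  next
    case False
    then obtain v where v: "v \<in> S" "v \<noteq> 0"
      using S subspace_0 by blast
    have cont: "continuous_on A (\<lambda>v. G v v)" for A
      by (rule bilinear_continuous_on_compose[OF continuous_on_id continuous_on_id G])
    have "compact (sphere 0 1 \<inter> S)"
      by (intro compact_Int_closed closed_subspace S) auto
    moreover have "(1 / norm v) *\<^sub>R v \<in> sphere 0 1 \<inter> S"
      using v S by (simp add: subspace_scale)
    ultimately have "\<exists>b\<in>sphere 0 1 \<inter> S. \<forall>y\<in>sphere 0 1 \<inter> S. G y y \<le> G b b"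
      by (intro continuous_attains_sup cont) blast+
    then obtain b where b: "b \<in> S" "norm b = 1"
      and max: "\<And>y. y \<in> S \<Longrightarrow> norm y = 1 \<Longrightarrow> G y y \<le> G b b"
      by auto
    have bb: "b \<bullet> b = 1"
      using b by (simp add: norm_eq_1)
    have max': "G y y \<le> G b b * (y \<bullet> y)" if "y \<in> S" for y
    proof (cases "y = 0")
      case False
      have "G ((1 / norm y) *\<^sub>R y) ((1 / norm y) *\<^sub>R y) \<le> G b b"
        using False that S by (intro max) (auto simp: subspace_scale)
      then have "G y y / (norm y)\<^sup>2 \<le> G b b"
        by (simp add: bilinear_lmul[OF G] bilinear_rmul[OF G] power2_eq_square)
      then show ?thesis
        using False by (simp add: pos_divide_le_eq power2_norm_eq_inner)
    qed (simp add: bilinear_lzero[OF G])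
    \<comment> \<open>First-order condition at the maximum: along \<open>b + t *\<^sub>R w\<close>
      the inequality \<open>max'\<close> becomes a quadratic polynomial in \<open>t\<close> with no
      constant term that is never positive, so its linear coefficient vanishes.\<close>
    have orth: "G b w = 0" if w: "w \<in> S" "b \<bullet> w = 0" for w
    proof -
      define c where "c = G w w - G b b * (w \<bullet> w)"
      have *: "2 * t * G b w + t\<^sup>2 * c \<le> 0" for t
      proof -
        have "G (b + t *\<^sub>R w) (b + t *\<^sub>R w) \<le> G b b * ((b + t *\<^sub>R w) \<bullet> (b + t *\<^sub>R w))"
          using b w S by (intro max') (auto simp: subspace_add subspace_scale)
        then show ?thesis
          using w bb sym[of w b]
          by (simp add: bilinear_ladd[OF G] bilinear_radd[OF G] bilinear_lmul[OF G]
              bilinear_rmul[OF G] inner_add_left inner_add_right inner_commute[of w b] c_def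
              algebra_simps power2_eq_square)
      qed
      show ?thesis
      proof (rule ccontr)
        assume ne: "G b w \<noteq> 0"
        \<comment> \<open>Small enough for the linear term to dominate: it contributes
          \<open>2 * t\<^sup>2 * (\<bar>c\<bar> + 1)\<close>, more than \<open>t\<^sup>2 * c\<close>
          can take away.\<close>
        define t where "t = G b w / (\<bar>c\<bar> + 1)"
        have tc: "G b w = t * (\<bar>c\<bar> + 1)"
          unfolding t_def by simp
        have "2 * t * G b w + t\<^sup>2 * c = t\<^sup>2 * (2 * (\<bar>c\<bar> + 1) + c)"
          unfolding tc by (simp add: power2_eq_square algebra_simps)
        also have "\<dots> > 0"
          using ne tc by (intro mult_pos_pos) auto
        finally show False
          using *[of t] by simp
      qed
    qed
    define S' where "S' = {w \<in> S. b \<bullet> w = 0}"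
    have S': "subspace S'"
      using S by (auto simp: S'_def subspace_def inner_add_right)
    have "b \<notin> S'"
      using bb by (simp add: S'_def)
    moreover have "S' \<subseteq> S"
      unfolding S'_def by blast
    ultimately have "S' \<subset> S"
      using b(1) by blast
    then have "dim S' < dim S"
      using S S' by (metis dim_psubset span_eq_iff)
    from less(1)[OF this S'] obtain B where B: "finite B" "pairwise orthogonal B"
      "\<And>b. b \<in> B \<Longrightarrow> norm b = 1" "span B = S'"
      "\<And>b w. b \<in> B \<Longrightarrow> w \<in> S' \<Longrightarrow> G b w = G b b * (b \<bullet> w)"
      by auto
    have BS: "b' \<in> S" "b \<bullet> b' = 0" if "b' \<in> B" for b'
      using that B(4) span_base by (auto simp: S'_def)
    have dec: "w - (b \<bullet> w) *\<^sub>R b \<in> S'" if "w \<in> S" for w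
      using that S b bb by (auto simp: S'_def subspace_diff subspace_scale inner_diff_right)
    show ?thesis
    proof (intro exI[of _ "insert b B"] conjI ballI)
      show "finite (insert b B)"
        using B by simp
      show "pairwise orthogonal (insert b B)"
        using B(2) BS by (auto simp: pairwise_insert orthogonal_def inner_commute)
      show "norm b' = 1" if "b' \<in> insert b B" for b'
        using that b B(3) by auto
      show "span (insert b B) = S"
      proof
        show "span (insert b B) \<subseteq> S"
          using BS b S by (intro span_minimal) auto
        show "S \<subseteq> span (insert b B)"
        proof
          fix w assume "w \<in> S"
          then have "w - (b \<bullet> w) *\<^sub>R b \<in> span B"
            using dec B(4) by simp
          then show "w \<in> span (insert b B)"
            by (auto simp: span_insert)
        qed
      qed
      fix b' w assume b': "b' \<in> insert b B" and w: "w \<in> S"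
      have split: "G b' w = (b \<bullet> w) * G b' b + G b' (w - (b \<bullet> w) *\<^sub>R b)" for b'
        by (simp add: bilinear_rsub[OF G] bilinear_rmul[OF G])
      show "G b' w = G b' b' * (b' \<bullet> w)"
      proof (cases "b' = b")
        case True
        then show ?thesis
          using split[of b] orth[of "w - (b \<bullet> w) *\<^sub>R b"] dec[OF w] by (simp add: S'_def)
      next
        case False
        then have b': "b' \<in> B"
          using b' by simp
        have "G b' b = 0"
          using orth BS[OF b'] sym by metis
        then show ?thesis
          using split[of b'] B(5)[OF b' dec[OF w]] BS(2)[OF b']
          by (simp add: inner_diff_right inner_commute)
      qed
    qed
  qed
qed


text \<open>The eigenspace of \<mu> is spanned by the basis vectors with
  \<open>G b b = \<mu>\<close>, so its dimension counts them, and grouping the basis by the value of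
  \<open>G b b\<close> turns the product over distinct eigenvalues into a product over the
  basis.\<close>

lemma eigenvalue_product_orthonormal:
  fixes q :: "'a::euclidean_space \<Rightarrow> real"
  assumes G: "bilinear G" and sym: "\<And>v w. G v w = G w v" and S: "subspace S"
    and q: "\<And>v. v \<in> S \<Longrightarrow> q v = G v v"
    and B: "finite B" "pairwise orthogonal B" "\<And>b. b \<in> B \<Longrightarrow> norm b = 1" "span B = S"
    and eig: "\<And>b w. b \<in> B \<Longrightarrow> w \<in> S \<Longrightarrow> G b w = G b b * (b \<bullet> w)"
  shows "eigenvalue_product S q = (\<Prod>b\<in>B. G b b)"
proof -
  have BS: "b \<in> S" if "b \<in> B" for b
    using that B(4) span_base by blast
  have nz: "0 \<notin> B"
    using B(3) by force
  have pol: "(q (v + w) - q v - q w) / 2 = G v w" if "v \<in> S" "w \<in> S" for v w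
    using that S q sym[of w v] by (simp add: subspace_add bilinear_ladd[OF G] bilinear_radd[OF G])
  have eigsp: "form_eigenspace S q \<mu> = span {b\<in>B. G b b = \<mu>}" for \<mu>
  proof -
    have *: "form_eigenspace S q \<mu> = {v\<in>S. \<forall>w\<in>S. G v w = \<mu> * (v \<bullet> w)}"
      unfolding form_eigenspace_def using pol by auto
    show ?thesis
    proof
      show "form_eigenspace S q \<mu> \<subseteq> span {b\<in>B. G b b = \<mu>}"
      proof
        fix v assume "v \<in> form_eigenspace S q \<mu>"
        then have v: "v \<in> S" "\<And>w. w \<in> S \<Longrightarrow> G v w = \<mu> * (v \<bullet> w)"
          by (auto simp: *)
        have "v = (\<Sum>b\<in>B. (v \<bullet> b) *\<^sub>R b)"
          using orthonormal_basis_expand[OF B(2,3) _ B(1)] v B(4) by simp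
        also have "\<dots> \<in> span {b\<in>B. G b b = \<mu>}"
        proof (rule span_sum)
          fix b assume b: "b \<in> B"
          \<comment> \<open>Both sides equal \<open>G v b\<close>, read off once from the
            eigenvector \<open>v\<close> and once from \<open>b\<close>. Hence only basis vectors
            with eigenvalue \<mu> occur in the expansion of \<open>v\<close>.\<close>
          have "\<mu> * (v \<bullet> b) = G b b * (v \<bullet> b)"
            using v(2)[OF BS[OF b]] trans[OF sym[of v b] eig[OF b v(1)]]
            by (simp only: inner_commute[of b v])
          then have "v \<bullet> b = 0 \<or> G b b = \<mu>"
            by (metis mult_right_cancel)
          then show "(v \<bullet> b) *\<^sub>R b \<in> span {b\<in>B. G b b = \<mu>}"
            using b by (metis (mono_tags, lifting) mem_Collect_eq scaleR_zero_left span_base span_scale span_zero)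
        qed
        finally show "v \<in> span {b\<in>B. G b b = \<mu>}" .
      qed
      have "subspace (form_eigenspace S q \<mu>)"
        unfolding *
      proof (rule subspaceI; clarsimp)
        show "0 \<in> S \<and> (\<forall>w\<in>S. G 0 w = 0)"
          using S by (simp add: subspace_0 bilinear_lzero[OF G])
        show "c *\<^sub>R v \<in> S \<and> (\<forall>w\<in>S. G (c *\<^sub>R v) w = \<mu> * (c * (v \<bullet> w)))"
          if "v \<in> S" "\<forall>w\<in>S. G v w = \<mu> * (v \<bullet> w)" for c v
          using that S by (simp add: subspace_scale bilinear_lmul[OF G])
        show "v + v' \<in> S \<and> (\<forall>w\<in>S. G (v + v') w = \<mu> * ((v + v') \<bullet> w))"
          if "v \<in> S" "v' \<in> S" "\<forall>w\<in>S. G v w = \<mu> * (v \<bullet> w)" "\<forall>w\<in>S. G v' w = \<mu> * (v' \<bullet> w)" for v v'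
          using that S by (simp add: subspace_add bilinear_ladd[OF G] inner_add_left distrib_left)
      qed
      then show "span {b\<in>B. G b b = \<mu>} \<subseteq> form_eigenspace S q \<mu>"
      proof (rule span_minimal[rotated], intro subsetI)
        fix b assume "b \<in> {b\<in>B. G b b = \<mu>}"
        then show "b \<in> form_eigenspace S q \<mu>"
          unfolding * using BS[of b] eig[of b] by auto
      qed
    qed
  qed
  have indep: "independent {b\<in>B. G b b = \<mu>}" for \<mu>
    using pairwise_orthogonal_independent[OF B(2) nz] by (rule independent_mono) auto
  have dim: "dim (form_eigenspace S q \<mu>) = card {b\<in>B. G b b = \<mu>}" for \<mu>
    unfolding eigsp using indep by (simp add: dim_eq_card_independent)
  have ne: "{\<mu>. form_eigenspace S q \<mu> \<noteq> {0}} = (\<lambda>b. G b b) ` B"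
  proof -
    have "form_eigenspace S q \<mu> \<noteq> {0} \<longleftrightarrow> (\<exists>b\<in>B. G b b = \<mu>)" for \<mu>
    proof
      assume "\<exists>b\<in>B. G b b = \<mu>"
      then obtain b where "b \<in> B" "G b b = \<mu>"
        by blast
      then have "b \<in> form_eigenspace S q \<mu>" "b \<noteq> 0"
        using nz unfolding eigsp by (auto intro: span_base)
      then show "form_eigenspace S q \<mu> \<noteq> {0}"
        by auto
    next
      assume "form_eigenspace S q \<mu> \<noteq> {0}"
      then have "{b\<in>B. G b b = \<mu>} \<noteq> {}"
        unfolding eigsp using span_empty by metis
      then show "\<exists>b\<in>B. G b b = \<mu>"
        by blast
    qed
    then show ?thesis
      by (simp only: image_def) (rule Collect_cong, metis)
  qed
  have "eigenvalue_product S q = (\<Prod>\<mu>\<in>(\<lambda>b. G b b) ` B. \<Prod>b | b \<in> B \<and> G b b = \<mu>. G b b)"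
    unfolding eigenvalue_product_def ne dim by (intro prod.cong) simp_all
  also have "\<dots> = (\<Prod>b\<in>B. G b b)"
    using B(1) by (rule prod.image_gen[symmetric])
  finally show ?thesis .
qed

section \<open>Volume of the model lens\<close>

text \<open>The base of the power is the radius of the slice of the unit model at height
  \<open>y\<close>; with the volume of the m-dimensional unit ball as a factor this is the volume of
  the model. The two branches of the minimum cross at \<tau> / (1 + \<tau>).\<close>

lemma has_integral_sqrt_min_power:
  fixes \<tau> :: real
  assumes "\<tau> > 0"
  shows "((\<lambda>y. sqrt (2 * min y (\<tau> * (1 - y))) ^ m) has_integral
    2 * sqrt (2 * \<tau> / (1 + \<tau>)) ^ m / (real m + 2)) {0..1}"
proof -
  define r where "r = \<tau> / (1 + \<tau>)"
  have r: "0 < r" "r < 1" "\<tau> * (1 - r) = r" "1 + 1 / \<tau> = 1 / r"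
    using assms by (auto simp: r_def field_simps)
  let ?f = "\<lambda>y. sqrt (2 * min y (\<tau> * (1 - y))) ^ m"
  \<comment> \<open>With w = sqrt (2 y) one has w' = 1 / w, so w^(m+2) / (m+2) is an antiderivative
    of w^m. The root has no derivative at 0 (on the other branch: at 1), hence the fundamental
    theorem that differentiates only in the interior.\<close>
  have "((\<lambda>y. sqrt (2 * y) ^ m) has_integral
      sqrt (2 * r) ^ (m + 2) / (real m + 2) - sqrt (2 * 0) ^ (m + 2) / (real m + 2)) {0..r}"
  proof (rule fundamental_theorem_of_calculus_interior)
    fix y assume y: "y \<in> {0<..<r}"
    define w where "w = sqrt (2 * y)"
    have w: "w > 0"
      using y by (simp add: w_def)
    have "((\<lambda>y. sqrt (2 * y)) has_real_derivative inverse w) (at y)"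
      unfolding w_def using y by (auto intro!: derivative_eq_intros)
    from DERIV_cdivide[OF DERIV_power[OF this, of "m + 2"], of "real m + 2"]
    have "((\<lambda>y. sqrt (2 * y) ^ (m + 2) / (real m + 2)) has_real_derivative w ^ m) (at y)"
      by (rule DERIV_cong) (use w in \<open>simp add: divide_simps flip: w_def\<close>)
    then show "((\<lambda>y. sqrt (2 * y) ^ (m + 2) / (real m + 2)) has_vector_derivative sqrt (2 * y) ^ m) (at y)"
      by (simp add: has_real_derivative_iff_has_vector_derivative w_def)
  qed (use r in \<open>auto intro!: continuous_intros\<close>)
  moreover have "sqrt (2 * y) ^ m = ?f y" if "y \<in> {0..r}" for y
  proof -
    have "\<tau> * (1 - r) \<le> \<tau> * (1 - y)"
      using that assms by (intro mult_left_mono) auto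
    then show ?thesis
      using that r by (simp add: min_def)
  qed
  ultimately have 1: "(?f has_integral sqrt (2 * r) ^ (m + 2) / (real m + 2)) {0..r}"
    by (subst has_integral_cong[of _ _ "\<lambda>y. sqrt (2 * y) ^ m"]) auto
  have "((\<lambda>y. sqrt (2 * (\<tau> * (1 - y))) ^ m) has_integral
      - (sqrt (2 * (\<tau> * (1 - 1))) ^ (m + 2)) / (\<tau> * (real m + 2)) -
      (- (sqrt (2 * (\<tau> * (1 - r))) ^ (m + 2)) / (\<tau> * (real m + 2)))) {r..1}"
  proof (rule fundamental_theorem_of_calculus_interior)
    fix y assume y: "y \<in> {r<..<1}"
    define w where "w = sqrt (2 * (\<tau> * (1 - y)))"
    have pos: "0 < 2 * (\<tau> * (1 - y))"
      using y assms by simp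
    then have w: "w > 0"
      by (simp add: w_def)
    have "((\<lambda>y. sqrt (2 * (\<tau> * (1 - y)))) has_real_derivative - \<tau> * inverse w) (at y)"
      unfolding w_def using pos by (auto intro!: derivative_eq_intros)
    from DERIV_cdivide[OF DERIV_minus[OF DERIV_power[OF this, of "m + 2"]], of "\<tau> * (real m + 2)"]
    have "((\<lambda>y. - (sqrt (2 * (\<tau> * (1 - y))) ^ (m + 2)) / (\<tau> * (real m + 2))) has_real_derivative w ^ m) (at y)"
      by (rule DERIV_cong) (use w assms in \<open>simp add: divide_simps flip: w_def\<close>)
    then show "((\<lambda>y. - (sqrt (2 * (\<tau> * (1 - y))) ^ (m + 2)) / (\<tau> * (real m + 2)))
        has_vector_derivative sqrt (2 * (\<tau> * (1 - y))) ^ m) (at y)"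
      by (simp add: has_real_derivative_iff_has_vector_derivative w_def)
  qed (use r assms in \<open>auto intro!: continuous_intros\<close>)
  moreover have "sqrt (2 * (\<tau> * (1 - y))) ^ m = ?f y" if "y \<in> {r..1}" for y
  proof -
    have "\<tau> * (1 - y) \<le> \<tau> * (1 - r)"
      using that assms by (intro mult_left_mono) auto
    then show ?thesis
      using that r by (simp add: min_absorb2)
  qed
  ultimately have 2: "(?f has_integral sqrt (2 * r) ^ (m + 2) / (\<tau> * (real m + 2))) {r..1}"
    by (subst has_integral_cong[of _ _ "\<lambda>y. sqrt (2 * (\<tau> * (1 - y))) ^ m"]) (auto simp: r)
  have split: "A / M + A / (\<tau> * M) = A / M * (1 + 1 / \<tau>)" for A M
    by (simp add: distrib_left mult.commute)
  \<comment> \<open>Together the two pieces carry the factor 1 + 1 / \<tau> = 1 / r, which cancels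
    the r in the two extra powers of the root.\<close>
  have "sqrt (2 * r) ^ (m + 2) / (real m + 2) + sqrt (2 * r) ^ (m + 2) / (\<tau> * (real m + 2)) =
      sqrt (2 * r) ^ (m + 2) / (real m + 2) * (1 + 1 / \<tau>)"
    by (rule split)
  also have "\<dots> = 2 * sqrt (2 * r) ^ m / (real m + 2)"
  proof -
    have "sqrt (2 * r) ^ (m + 2) = 2 * r * sqrt (2 * r) ^ m"
      using r(1) by (simp add: power_add)
    then show ?thesis
      unfolding r(4) \<open>sqrt (2 * r) ^ (m + 2) = _\<close> using r(1) by simp
  qed
  finally show ?thesis
    using has_integral_combine[OF _ _ 1 2] r by (simp add: r_def)
qed

text \<open>The model of depth 1 for the identity form, with \<open>k\<close> as depth axis; the
  other model lenses are affine images of it.\<close>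

definition paraboloid_lens :: "'a::euclidean_space \<Rightarrow> real \<Rightarrow> 'a set" where
  "paraboloid_lens k \<tau> = {z. (\<Sum>b\<in>Basis - {k}. (z \<bullet> b)\<^sup>2) \<le> 2 * (z \<bullet> k) \<and>
     (\<Sum>b\<in>Basis - {k}. (z \<bullet> b)\<^sup>2) \<le> 2 * \<tau> * (1 - z \<bullet> k)}"

lemma paraboloid_lens_borel: "paraboloid_lens k \<tau> \<in> sets borel"
  unfolding paraboloid_lens_def by measurable

text \<open>Lebesgue measure is the product measure over \<open>Basis\<close>. Integrating over the
  coordinate \<open>k\<close> last leaves balls of dimension \<open>m\<close> as slices.\<close>

lemma emeasure_paraboloid_lens:
  fixes k :: "'a::euclidean_space"
  assumes k: "k \<in> Basis" and \<tau>: "\<tau> > 0"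
  defines "m \<equiv> DIM('a) - 1"
  shows "emeasure lborel (paraboloid_lens k \<tau>) =
    ennreal (unit_ball_vol (real m) * (2 * sqrt (2 * \<tau> / (1 + \<tau>)) ^ m / (real m + 2)))"
proof -
  let ?B = "Basis - {k} :: 'a set"
  let ?M = "\<lambda>A. Pi\<^sub>M A (\<lambda>_. lborel) :: ('a \<Rightarrow> real) measure"
  let ?f = "\<lambda>y. sqrt (2 * min y (\<tau> * (1 - y))) ^ m"
  interpret product_sigma_finite "\<lambda>_::'a. lborel :: real measure"
    by standard
  define C where "C = {f. (\<Sum>b\<in>?B. (f b)\<^sup>2) \<le> 2 * f k \<and> (\<Sum>b\<in>?B. (f b)\<^sup>2) \<le> 2 * \<tau> * (1 - f k)} \<inter> space (?M Basis)"
  have Bk: "insert k ?B = Basis"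
    using k by auto
  have kB: "k \<notin> ?B" "finite ?B" "card ?B = m"
    using k by (auto simp: m_def)
  have C[measurable]: "C \<in> sets (?M Basis)"
  proof -
    have "C = {f \<in> space (?M Basis). (\<Sum>b\<in>?B. (f b)\<^sup>2) \<le> 2 * f k \<and> (\<Sum>b\<in>?B. (f b)\<^sup>2) \<le> 2 * \<tau> * (1 - f k)}"
      by (auto simp: C_def)
    also have "\<dots> \<in> sets (?M Basis)"
    proof -
      have k': "(\<lambda>f. f k) \<in> borel_measurable (?M Basis)"
        using measurable_component_singleton[OF k, of "\<lambda>_. lborel :: real measure"] by simp
      have sum: "(\<lambda>f. \<Sum>b\<in>?B. (f b)\<^sup>2) \<in> borel_measurable (?M Basis)"
      proof (intro borel_measurable_sum borel_measurable_power)
        fix b assume "b \<in> ?B"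
        then show "(\<lambda>f. f b) \<in> borel_measurable (?M Basis)"
          using measurable_component_singleton[of b Basis "\<lambda>_. lborel :: real measure"] by simp
      qed
      show ?thesis
        by (intro sets.sets_Collect_conj borel_measurable_le sum borel_measurable_times
            borel_measurable_diff borel_measurable_const k')
    qed
    finally show ?thesis .
  qed
  have "emeasure lborel (paraboloid_lens k \<tau>) = emeasure (?M Basis)
      ((\<lambda>f. \<Sum>b\<in>Basis. f b *\<^sub>R b) -` paraboloid_lens k \<tau> \<inter> space (?M Basis))"
    by (subst lborel_eq, subst emeasure_distr) (auto simp: paraboloid_lens_borel)
  also have "(\<lambda>f. \<Sum>b\<in>Basis. f b *\<^sub>R b) -` paraboloid_lens k \<tau> \<inter> space (?M Basis) = C"
    using k by (auto simp: C_def paraboloid_lens_def inner_sum_left_Basis)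
  also have "emeasure (?M Basis) C = (\<integral>\<^sup>+ f. indicator C f \<partial>?M Basis)"
    by simp
  also have "\<dots> = (\<integral>\<^sup>+ f. indicator C f \<partial>?M (insert k ?B))"
    by (simp only: Bk)
  also have "\<dots> = (\<integral>\<^sup>+ y. \<integral>\<^sup>+ f. indicator C (f(k := y)) \<partial>?M ?B \<partial>lborel)"
    using kB C Bk by (intro product_nn_integral_insert_rev) (auto simp del: insert_Diff_single)
  also have "\<dots> = (\<integral>\<^sup>+ y. ennreal (unit_ball_vol (real m) * (?f y * indicator {0..1} y)) \<partial>lborel)"
  proof (rule nn_integral_cong_AE)
    \<comment> \<open>The formula for the volume of a ball asks for a positive radius, so the two
      heights where the slice shrinks to a point are discarded as a null set.\<close>
    have "AE y in lborel. y \<notin> {0, 1::real}"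
      by (intro AE_not_in countable_imp_null_set_lborel) auto
    then show "AE y in lborel. (\<integral>\<^sup>+ f. indicator C (f(k := y)) \<partial>?M ?B) =
        ennreal (unit_ball_vol (real m) * (?f y * indicator {0..1} y))"
    proof eventually_elim
      case (elim y)
      let ?\<rho> = "2 * min y (\<tau> * (1 - y))"
      have eq: "indicator C (f(k := y)) = (if (\<Sum>b\<in>?B. (f b)\<^sup>2) \<le> ?\<rho> then 1 else (0::ennreal))"
        if "f \<in> space (?M ?B)" for f
      proof -
        have "f(k := y) \<in> space (?M Basis)"
          using that k by (auto simp: space_PiM PiE_def extensional_def)
        moreover have "(\<Sum>b\<in>?B. ((f(k := y)) b)\<^sup>2) = (\<Sum>b\<in>?B. (f b)\<^sup>2)"
          by (intro sum.cong) auto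
        ultimately have "f(k := y) \<in> C \<longleftrightarrow> (\<Sum>b\<in>?B. (f b)\<^sup>2) \<le> ?\<rho>"
          unfolding C_def by (simp add: min_def mult.assoc) linarith
        then show ?thesis
          by (simp add: indicator_def)
      qed
      show ?case
      proof (cases "0 < y \<and> y < 1")
        case True
        then have \<rho>: "?\<rho> > 0"
          using \<tau> by simp
        have "(\<integral>\<^sup>+ f. indicator C (f(k := y)) \<partial>?M ?B) =
            (\<integral>\<^sup>+ f. indicator ({f. sqrt (\<Sum>b\<in>?B. (f b)\<^sup>2) \<le> sqrt ?\<rho>} \<inter> space (?M ?B)) f \<partial>?M ?B)"
          by (intro nn_integral_cong, subst eq) (auto simp: indicator_def)
        also have "\<dots> = emeasure (?M ?B) ({f. sqrt (\<Sum>b\<in>?B. (f b)\<^sup>2) \<le> sqrt ?\<rho>} \<inter> space (?M ?B))"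
        proof (rule nn_integral_indicator)
          have "{f. sqrt (\<Sum>b\<in>?B. (f b)\<^sup>2) \<le> sqrt ?\<rho>} \<inter> space (?M ?B) =
             {f \<in> space (?M ?B). sqrt (\<Sum>b\<in>?B. (f b)\<^sup>2) \<le> sqrt ?\<rho>}"
            by auto
          also have "\<dots> \<in> sets (?M ?B)"
            by measurable
          finally show "{f. sqrt (\<Sum>b\<in>?B. (f b)\<^sup>2) \<le> sqrt ?\<rho>} \<inter> space (?M ?B) \<in> sets (?M ?B)" .
        qed
        also have "\<dots> = ennreal (unit_ball_vol (real m) * sqrt ?\<rho> ^ m)"
          using emeasure_cball_aux[OF kB(2), of "sqrt ?\<rho>"] \<rho> unfolding kB(3) by (simp only: real_sqrt_gt_0_iff)
        finally show ?thesis
          using True by simp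
      next
        case False
        then have "y < 0 \<or> y > 1"
          using elim by auto
        then have "y < 0 \<or> \<tau> * (1 - y) < 0"
          using \<tau> by (auto simp: mult_less_0_iff)
        then have "?\<rho> < 0"
          by linarith
        then have "\<not> (\<Sum>b\<in>?B. (f b)\<^sup>2) \<le> ?\<rho>" for f
          using sum_nonneg[of ?B "\<lambda>b. (f b)\<^sup>2"] by fastforce
        then have "(\<integral>\<^sup>+ f. indicator C (f(k := y)) \<partial>?M ?B) = (\<integral>\<^sup>+ f. 0 \<partial>?M ?B)"
          by (intro nn_integral_cong) (simp only: eq if_False)
        then show ?thesis
          using \<open>y < 0 \<or> y > 1\<close> by auto
      qed
    qed
  qed
  also have "\<dots> = ennreal (unit_ball_vol (real m)) * (\<integral>\<^sup>+ y. ennreal (?f y * indicator {0..1} y) \<partial>lborel)"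
    by (subst nn_integral_cmult[symmetric]) (auto simp: ennreal_mult')
  also have "(\<integral>\<^sup>+ y. ennreal (?f y * indicator {0..1} y) \<partial>lborel) = ennreal (2 * sqrt (2 * \<tau> / (1 + \<tau>)) ^ m / (real m + 2))"
  proof (rule nn_integral_has_integral_lborel)
    show "(\<lambda>y. ?f y * indicator {0..1} y) \<in> borel_measurable borel"
      by measurable
    show "0 \<le> ?f y * indicator {0..1} y" for y
      using \<tau> by (auto simp: indicator_def)
    show "((\<lambda>y. ?f y * indicator {0..1} y) has_integral 2 * sqrt (2 * \<tau> / (1 + \<tau>)) ^ m / (real m + 2)) UNIV"
    proof -
      have "(\<lambda>y. ?f y * indicator {0..1} y) = (\<lambda>y. if y \<in> {0..1} then ?f y else 0)"
        by (auto simp: fun_eq_iff)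
      then show ?thesis
        using has_integral_sqrt_min_power[OF \<tau>, of m] by (simp only: has_integral_restrict_UNIV)
    qed
  qed
  finally show ?thesis
    by (simp only: ennreal_mult'[OF unit_ball_vol_nonneg[OF of_nat_0_le_iff]])
qed

corollary
  fixes k :: "'a::euclidean_space"
  assumes k: "k \<in> Basis" and \<tau>: "\<tau> > 0"
  shows lmeasurable_paraboloid_lens: "paraboloid_lens k \<tau> \<in> lmeasurable"
    and measure_paraboloid_lens: "measure lebesgue (paraboloid_lens k \<tau>) =
      unit_ball_vol (real (DIM('a) - 1)) *
      (2 * sqrt (2 * \<tau> / (1 + \<tau>)) ^ (DIM('a) - 1) / (real (DIM('a) - 1) + 2))"
proof -
  have b: "paraboloid_lens k \<tau> \<in> sets lborel"
    using paraboloid_lens_borel by simp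
  show "paraboloid_lens k \<tau> \<in> lmeasurable"
    by (rule fmeasurableI) (use b emeasure_paraboloid_lens[OF assms] in auto)
  show "measure lebesgue (paraboloid_lens k \<tau>) = unit_ball_vol (real (DIM('a) - 1)) *
      (2 * sqrt (2 * \<tau> / (1 + \<tau>)) ^ (DIM('a) - 1) / (real (DIM('a) - 1) + 2))"
    using emeasure_paraboloid_lens[OF assms] \<tau> b by (simp add: measure_def)
qed

text \<open>\<open>R\<close> is an affine image of the unit model: the depth axis goes to - (h / s)
  x and the others to sqrt (h / \<nu> b) b. That the depth axis points along \<open>x\<close> and
  not along \<open>N\<close> amounts to a shear and does not change the volume.\<close>

lemma measure_model_lens:
  fixes x N :: "real^'n" and \<nu> :: "real^'n \<Rightarrow> real"
  assumes N: "norm N = 1" and s: "x \<bullet> N = s" "s > 0" and "h > 0" "\<tau> > 0"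
    and B: "finite B" "pairwise orthogonal B" "\<And>b. b \<in> B \<Longrightarrow> norm b = 1" "span B = {w. w \<bullet> N = 0}"
    and \<nu>: "\<And>b. b \<in> B \<Longrightarrow> \<nu> b > 0"
  defines "R \<equiv> {x - (t / s) *\<^sub>R x + w | t w. w \<bullet> N = 0 \<and> (\<Sum>b\<in>B. \<nu> b * (w \<bullet> b)\<^sup>2) \<le> 2 * t \<and>
      (\<Sum>b\<in>B. \<nu> b * (w \<bullet> b)\<^sup>2) \<le> 2 * \<tau> * (h - t)}"
    and "m \<equiv> CARD('n) - 1"
  shows "R \<in> lmeasurable \<and> measure lebesgue R =
    unit_ball_vol (real m) * (2 * sqrt (2 * \<tau> / (1 + \<tau>)) ^ m / (real m + 2)) *
    (h * sqrt h ^ m / sqrt (\<Prod>b\<in>B. \<nu> b))"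
proof -
  \<comment> \<open>An arbitrary index serves as depth coordinate; the other \<open>m\<close>
    indices label the vectors of \<open>B\<close>.\<close>
  obtain k :: 'n where True
    by simp
  let ?I = "- {k}"
  let ?P = "paraboloid_lens (axis k 1 :: real^'n) \<tau>"
  have NN: "N \<bullet> N = 1"
    using N by (simp add: norm_eq_1)
  have nz: "0 \<notin> B"
    using B(3) by force
  have "card B = dim (span B)"
    using pairwise_orthogonal_independent[OF B(2) nz] by (simp add: dim_eq_card_independent)
  also have "\<dots> = m"
  proof -
    have "N \<noteq> 0"
      using N by auto
    from dim_hyperplane[OF this] show ?thesis
      by (simp add: B(4) m_def inner_commute)
  qed
  finally have cB: "card B = m" .
  have cI: "card ?I = m"
    by (simp add: m_def card_Diff_singleton Compl_eq_Diff_UNIV)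
  obtain \<beta> where \<beta>: "bij_betw \<beta> ?I B"
    using finite_same_card_bij[of ?I B] cB cI B(1) by auto
  have \<beta>B: "\<beta> i \<in> B" if "i \<noteq> k" for i
    using \<beta> that by (auto simp: bij_betw_def)
  have \<beta>N: "\<beta> i \<bullet> N = 0" if "i \<noteq> k" for i
    using \<beta>B[OF that] B(4) span_base by blast
  have \<beta>1: "\<beta> i \<bullet> \<beta> i = 1" if "i \<noteq> k" for i
    using B(3)[OF \<beta>B[OF that]] by (simp add: norm_eq_1)
  have \<beta>0: "\<beta> i \<bullet> \<beta> j = 0" if "i \<noteq> k" "j \<noteq> k" "i \<noteq> j" for i j
  proof -
    have "\<beta> i \<noteq> \<beta> j"
      using \<beta> that by (auto simp: bij_betw_def inj_on_def)
    then show ?thesis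
      using B(2) \<beta>B that by (auto simp: pairwise_def orthogonal_def)
  qed
  \<comment> \<open>With these factors the weighted form becomes h times a plain sum of squares and
    the depth becomes h times the coordinate \<open>k\<close>, so h divides out of both
    inequalities.\<close>
  define c where "c i = (if i = k then h else sqrt (h / \<nu> (\<beta> i)))" for i
  define a where "a i = (if i = k then - (1 / s) *\<^sub>R x else \<beta> i)" for i
  define f where "f z = (\<Sum>i\<in>UNIV. z$i *\<^sub>R (c i *\<^sub>R a i))" for z :: "real^'n"
  have cpos: "c i \<noteq> 0" for i
    using \<open>h > 0\<close> \<nu>[OF \<beta>B] by (simp add: c_def order_less_imp_not_eq2)
  have lin: "linear f"
    unfolding f_def by (rule linearI) (simp_all add: scaleR_add_left distrib_right sum.distrib scaleR_sum_right mult.assoc)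
  have f_split: "f z = - ((h * z$k / s) *\<^sub>R x) + (\<Sum>i\<in>?I. (z$i * c i) *\<^sub>R \<beta> i)" for z
  proof -
    have "f z = z$k *\<^sub>R (c k *\<^sub>R a k) + (\<Sum>i\<in>UNIV - {k}. z$i *\<^sub>R (c i *\<^sub>R a i))"
      unfolding f_def by (rule sum.remove) auto
    also have "(\<Sum>i\<in>UNIV - {k}. z$i *\<^sub>R (c i *\<^sub>R a i)) = (\<Sum>i\<in>?I. (z$i * c i) *\<^sub>R \<beta> i)"
      by (rule sum.cong) (auto simp: a_def)
    finally show ?thesis
      by (simp add: a_def c_def mult.commute)
  qed
  have "matrix f = transpose (\<chi> i. c i *s a i)"
  proof -
    have "f (axis j 1) = c j *\<^sub>R a j" for j
    proof -
      have "f (axis j 1) = (\<Sum>i\<in>UNIV. if i = j then c i *\<^sub>R a i else 0)"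
        unfolding f_def by (intro sum.cong) (auto simp: axis_def)
      then show ?thesis
        by simp
    qed
    then show ?thesis
      by (simp add: matrix_def transpose_def vec_eq_iff)
  qed
  then have "det (matrix f) = prod c UNIV * det (\<chi> i. a i)"
    by (simp only: det_transpose det_rows_mul)
  moreover have "\<bar>det (\<chi> i. a i)\<bar> = 1"
  proof -
    \<comment> \<open>With - N in place of - x / s the rows are orthonormal. The exchange leaves the
      determinant alone: N - x / s is orthogonal to N because \<open>x \<bullet> N = s\<close>, so
      it lies in the span of the other rows.\<close>
    define A where "A = (\<chi> i. if i = k then - N else \<beta> i)"
    have row: "row i A = (if i = k then - N else \<beta> i)" for i
      by (simp add: A_def row_def vec_eq_iff)
    have "orthogonal_matrix A"
      unfolding orthogonal_matrix_orthonormal_rows row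
      using N NN \<beta>N \<beta>1 \<beta>0 by (auto simp: norm_eq_1 orthogonal_def inner_commute)
    then have "\<bar>det A\<bar> = 1"
      using det_orthogonal_matrix by fastforce
    moreover have "{row j A |j. j \<noteq> k} = B"
    proof -
      have "{row j A |j. j \<noteq> k} = \<beta> ` ?I"
        by (auto simp: row)
      then show ?thesis
        using \<beta> by (simp add: bij_betw_def)
    qed
    moreover have "N - (1 / s) *\<^sub>R x \<in> span B"
      using s NN by (simp add: B(4) inner_diff_left)
    moreover have "(\<chi> i. a i) = (\<chi> i. if i = k then row k A + (N - (1 / s) *\<^sub>R x) else row i A)"
      by (simp add: a_def row vec_eq_iff)
    ultimately show ?thesis
      using det_row_span[of "N - (1 / s) *\<^sub>R x" A k] by (simp add: span_vec_eq)
  qed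
  moreover have "prod c UNIV = h * sqrt h ^ m / sqrt (\<Prod>b\<in>B. \<nu> b)"
  proof -
    have "prod c UNIV = c k * (\<Prod>i\<in>?I. c i)"
      by (subst prod.remove[of _ k]) (auto simp: Compl_eq_Diff_UNIV)
    also have "(\<Prod>i\<in>?I. c i) = (\<Prod>i\<in>?I. sqrt (h / \<nu> (\<beta> i)))"
      by (rule prod.cong) (auto simp: c_def)
    also have "\<dots> = (\<Prod>b\<in>B. sqrt (h / \<nu> b))"
      by (rule prod.reindex_bij_betw[OF \<beta>])
    also have "\<dots> = sqrt h ^ m / sqrt (\<Prod>b\<in>B. \<nu> b)"
    proof -
      have "(\<Prod>b\<in>A. sqrt (\<nu> b)) = sqrt (\<Prod>b\<in>A. \<nu> b)" for A
        by (induction A rule: infinite_finite_induct) (auto simp: real_sqrt_mult)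
      then show ?thesis
        by (simp add: real_sqrt_divide prod_dividef cB)
    qed
    finally show ?thesis
      by (simp add: c_def)
  qed
  ultimately have det: "\<bar>det (matrix f)\<bar> = h * sqrt h ^ m / sqrt (\<Prod>b\<in>B. \<nu> b)"
    using \<nu> \<open>h > 0\<close> by (simp add: abs_mult prod_nonneg less_imp_le)
  have P: "z \<in> ?P \<longleftrightarrow> (\<Sum>i\<in>?I. (z$i)\<^sup>2) \<le> 2 * z$k \<and> (\<Sum>i\<in>?I. (z$i)\<^sup>2) \<le> 2 * \<tau> * (1 - z$k)" for z
  proof -
    have "Basis - {axis k 1 :: real^'n} = (\<lambda>i. axis i 1) ` ?I"
      by (auto simp: Basis_vec_def axis_eq_axis)
    moreover have "inj_on (\<lambda>i. axis i 1 :: real^'n) ?I"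
      by (auto simp: inj_on_def axis_eq_axis)
    ultimately have "(\<Sum>b\<in>Basis - {axis k 1}. (z \<bullet> b)\<^sup>2) = (\<Sum>i\<in>?I. (z$i)\<^sup>2)"
      by (simp add: sum.reindex inner_axis)
    then show ?thesis
      by (simp add: paraboloid_lens_def inner_axis)
  qed
  have form: "(\<Sum>b\<in>B. \<nu> b * (w \<bullet> b)\<^sup>2) = h * (\<Sum>i\<in>?I. (z$i)\<^sup>2)"
    if "\<And>i. i \<noteq> k \<Longrightarrow> w \<bullet> \<beta> i = z$i * c i" for w and z :: "real^'n"
  proof -
    have "(\<Sum>b\<in>B. \<nu> b * (w \<bullet> b)\<^sup>2) = (\<Sum>i\<in>?I. \<nu> (\<beta> i) * (w \<bullet> \<beta> i)\<^sup>2)"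
      by (rule sum.reindex_bij_betw[OF \<beta>, symmetric])
    also have "\<dots> = (\<Sum>i\<in>?I. h * (z$i)\<^sup>2)"
    proof (rule sum.cong)
      fix i assume "i \<in> ?I"
      then have "i \<noteq> k"
        by simp
      then have \<nu>i: "\<nu> (\<beta> i) > 0"
        using \<nu>[OF \<beta>B] by simp
      have "(sqrt (h / \<nu> (\<beta> i)))\<^sup>2 = h / \<nu> (\<beta> i)"
        using \<nu>i \<open>h > 0\<close> by (intro real_sqrt_pow2) simp
      then show "\<nu> (\<beta> i) * (w \<bullet> \<beta> i)\<^sup>2 = h * (z$i)\<^sup>2"
        using \<nu>i that[OF \<open>i \<noteq> k\<close>] \<open>i \<noteq> k\<close> by (simp add: power_mult_distrib c_def)
    qed simp
    finally show ?thesis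
      by (simp add: sum_distrib_left)
  qed
  have scale: "h * S \<le> 2 * t \<and> h * S \<le> 2 * \<tau> * (h - t) \<longleftrightarrow> S \<le> 2 * u \<and> S \<le> 2 * \<tau> * (1 - u)"
    if "t = h * u" for S t u
  proof -
    have "2 * t = h * (2 * u)" "2 * \<tau> * (h - t) = h * (2 * \<tau> * (1 - u))"
      by (simp_all add: that algebra_simps)
    then show ?thesis
      using \<open>h > 0\<close> by (simp only: mult_le_cancel_left_pos)
  qed
  have R: "R = (+) x ` f ` ?P"
  proof (intro set_eqI iffI)
    fix p assume "p \<in> R"
    then obtain t w where p: "p = x - (t / s) *\<^sub>R x + w" "w \<bullet> N = 0"
      and tw: "(\<Sum>b\<in>B. \<nu> b * (w \<bullet> b)\<^sup>2) \<le> 2 * t \<and> (\<Sum>b\<in>B. \<nu> b * (w \<bullet> b)\<^sup>2) \<le> 2 * \<tau> * (h - t)"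
      unfolding R_def by blast
    define z where "z = (\<chi> i. if i = k then t / h else (w \<bullet> \<beta> i) / c i)"
    have zk: "z$k = t / h" and zi: "\<And>i. i \<noteq> k \<Longrightarrow> w \<bullet> \<beta> i = z$i * c i"
      using cpos by (simp_all add: z_def)
    have "t = h * z$k"
      using \<open>h > 0\<close> by (simp add: zk)
    have "z \<in> ?P"
    proof -
      have "(\<Sum>b\<in>B. \<nu> b * (w \<bullet> b)\<^sup>2) = h * (\<Sum>i\<in>?I. (z$i)\<^sup>2)"
        by (rule form) (rule zi)
      from tw[unfolded this] have "h * (\<Sum>i\<in>?I. (z$i)\<^sup>2) \<le> 2 * t \<and> h * (\<Sum>i\<in>?I. (z$i)\<^sup>2) \<le> 2 * \<tau> * (h - t)" .
      from this[unfolded scale[OF \<open>t = h * z$k\<close>]] show ?thesis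
        unfolding P .
    qed
    moreover have "f z = - ((t / s) *\<^sub>R x) + w"
    proof -
      have "(\<Sum>i\<in>?I. (z$i * c i) *\<^sub>R \<beta> i) = (\<Sum>i\<in>?I. (w \<bullet> \<beta> i) *\<^sub>R \<beta> i)"
        by (intro sum.cong) (auto simp: zi)
      also have "\<dots> = (\<Sum>b\<in>B. (w \<bullet> b) *\<^sub>R b)"
        by (rule sum.reindex_bij_betw[OF \<beta>])
      also have "\<dots> = w"
        using p(2) B by (intro orthonormal_basis_expand) auto
      finally show ?thesis
        using \<open>h > 0\<close> by (simp add: f_split zk)
    qed
    ultimately show "p \<in> (+) x ` f ` ?P"
      unfolding p(1) image_image by (intro image_eqI[of _ _ z]) auto
  next
    fix p assume "p \<in> (+) x ` f ` ?P"
    then obtain z where z: "z \<in> ?P" "p = x + f z"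
      by auto
    define w where "w = (\<Sum>i\<in>?I. (z$i * c i) *\<^sub>R \<beta> i)"
    have "w \<bullet> N = 0"
      unfolding w_def inner_sum_left by (intro sum.neutral) (auto simp: \<beta>N)
    moreover have "w \<bullet> \<beta> i = z$i * c i" if "i \<noteq> k" for i
    proof -
      have "w \<bullet> \<beta> i = (\<Sum>j\<in>?I. if j = i then z$i * c i else 0)"
        unfolding w_def inner_sum_left using that by (intro sum.cong) (auto simp: \<beta>1 \<beta>0)
      then show ?thesis
        using that by simp
    qed
    moreover have "p = x - ((h * z$k) / s) *\<^sub>R x + w"
      by (simp add: z f_split w_def)
    moreover have "h * (\<Sum>i\<in>?I. (z$i)\<^sup>2) \<le> 2 * (h * z$k) \<and> h * (\<Sum>i\<in>?I. (z$i)\<^sup>2) \<le> 2 * \<tau> * (h - h * z$k)"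
      using z(1) by (simp only: P scale[OF refl])
    ultimately show "p \<in> R"
      unfolding R_def using form[of w z] by force
  qed
  have ax: "axis k 1 \<in> (Basis :: (real^'n) set)"
    by (simp add: axis_in_Basis_iff)
  show ?thesis
    unfolding R
    using linear_image_finite_cart[OF lin lmeasurable_paraboloid_lens[OF ax \<open>\<tau> > 0\<close>]]
      measure_paraboloid_lens[OF ax \<open>\<tau> > 0\<close>] det
    by (simp add: measurable_translation measure_translation m_def mult.commute)
qed

section \<open>Paraboloids at a normal point\<close>

text \<open>If \<open>y\<close> were outside, let \<open>a\<close> be its nearest point in
  \<open>A\<close> and move from \<open>y\<close> by \<open>r\<close> straight away from
  \<open>a\<close>. The supporting hyperplane at \<open>a\<close> keeps all of \<open>A\<close> at
  distance more than \<open>r\<close> from the point reached. This converts Hausdorff proximity into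
  membership.\<close>

lemma mem_closed_convex_of_nearby:
  fixes A :: "'a::euclidean_space set"
  assumes A: "closed A" "convex A" "A \<subseteq> S" and S: "subspace S" and y: "y \<in> S" and "r > 0"
    and near: "\<And>v. v \<in> S \<Longrightarrow> dist v y \<le> r \<Longrightarrow> \<exists>z\<in>A. dist z v < r"
  shows "y \<in> A"
proof (rule ccontr)
  assume "y \<notin> A"
  have "A \<noteq> {}"
    using near[OF y] \<open>r > 0\<close> by auto
  then obtain a where a: "a \<in> A" "\<forall>z\<in>A. dist y a \<le> dist y z"
    using distance_attains_inf[OF A(1)] by metis
  define u where "u = y - a"
  have u: "norm u > 0"
    using \<open>y \<notin> A\<close> a(1) by (auto simp: u_def)
  define v where "v = y + (r / norm u) *\<^sub>R u"
  have "v \<in> S"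
    using S y a(1) A(3) by (auto simp: v_def u_def intro!: subspace_add subspace_scale subspace_diff)
  moreover have "dist v y \<le> r"
    using u \<open>r > 0\<close> by (simp add: v_def dist_norm)
  ultimately obtain z where z: "z \<in> A" "dist z v < r"
    using near by blast
  have "u \<bullet> (z - a) \<le> 0"
    unfolding u_def using any_closest_point_dot[OF A(2,1) a(1) z(1) a(2)] .
  moreover have "(v - z) \<bullet> u = u \<bullet> u + r * norm u - u \<bullet> (z - a)"
  proof -
    have "v - z = u + (r / norm u) *\<^sub>R u - (z - a)"
      by (simp add: v_def u_def)
    then have "(v - z) \<bullet> u = u \<bullet> u + (r / norm u) * (u \<bullet> u) - u \<bullet> (z - a)"
      by (simp only: inner_diff_left inner_add_left inner_scaleR_left inner_commute[of u "z - a"])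
    also have "(r / norm u) * (u \<bullet> u) = r * norm u"
      using u by (simp add: power2_norm_eq_inner[symmetric] power2_eq_square)
    finally show ?thesis .
  qed
  moreover have "(v - z) \<bullet> u \<le> norm (v - z) * norm u"
    by (rule norm_cauchy_schwarz)
  moreover have "norm (v - z) * norm u < r * norm u"
    using z(2) u by (simp add: dist_norm norm_minus_commute)
  moreover have "u \<bullet> u \<ge> 0"
    by simp
  ultimately show False
    by linarith
qed

lemma converges_locallyD:
  assumes "converges_locally A L F" "R > 0" "e > 0"
  shows "\<forall>\<^sub>F h in F. (\<forall>y\<in>A h \<inter> cball 0 R. \<exists>z\<in>L. dist y z < e) \<and>
    (\<forall>z\<in>L \<inter> cball 0 R. \<exists>y\<in>A h. dist y z < e)"
  using assms unfolding converges_locally_def by blast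

lemma converges_locally_translate:
  assumes A: "converges_locally A L F" and \<sigma>: "(\<sigma> \<longlongrightarrow> 0) F"
  shows "converges_locally (\<lambda>h. (\<lambda>y. y + \<sigma> h) ` A h) L F"
  unfolding converges_locally_def
proof (intro allI impI)
  \<comment> \<open>The shift can move points into the ball of radius \<open>R\<close>, so
    convergence is used in a ball larger by 1 and the shift is kept below 1; half of
    \<open>e\<close> is reserved for the shift itself.\<close>
  fix R e :: real assume "R > 0" "e > 0"
  have "\<forall>\<^sub>F h in F. (\<forall>y\<in>A h \<inter> cball 0 (R + 1). \<exists>z\<in>L. dist y z < e / 2) \<and>
      (\<forall>z\<in>L \<inter> cball 0 (R + 1). \<exists>y\<in>A h. dist y z < e / 2)"
    using \<open>R > 0\<close> \<open>e > 0\<close> by (intro converges_locallyD[OF A]) auto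
  moreover have "\<forall>\<^sub>F h in F. norm (\<sigma> h) < min 1 (e / 2)"
    using tendstoD[OF \<sigma>, of "min 1 (e / 2)"] \<open>e > 0\<close> by simp
  ultimately show "\<forall>\<^sub>F h in F. (\<forall>y\<in>(\<lambda>y. y + \<sigma> h) ` A h \<inter> cball 0 R. \<exists>z\<in>L. dist y z < e) \<and>
      (\<forall>z\<in>L \<inter> cball 0 R. \<exists>y\<in>(\<lambda>y. y + \<sigma> h) ` A h. dist y z < e)"
  proof eventually_elim
    case (elim h)
    have tri: "dist (y + \<sigma> h) z < e" if "dist y z < e / 2" for y z
    proof -
      have "dist (y + \<sigma> h) z \<le> dist (y + \<sigma> h) y + dist y z"
        by (rule dist_triangle)
      also have "dist (y + \<sigma> h) y = norm (\<sigma> h)"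
        by (simp add: dist_norm)
      finally show ?thesis
        using that elim by linarith
    qed
    show ?case
    proof (intro conjI ballI)
      fix y assume "y \<in> (\<lambda>y. y + \<sigma> h) ` A h \<inter> cball 0 R"
      then obtain a where a: "y = a + \<sigma> h" "a \<in> A h" "norm (a + \<sigma> h) \<le> R"
        by auto
      have "norm a \<le> norm (a + \<sigma> h) + norm (\<sigma> h)"
        using norm_triangle_ineq4[of "a + \<sigma> h" "\<sigma> h"] by simp
      then have "a \<in> A h \<inter> cball 0 (R + 1)"
        using a elim by auto
      then show "\<exists>z\<in>L. dist y z < e"
        using elim tri a(1) by blast
    next
      fix z assume "z \<in> L \<inter> cball 0 R"
      then have "z \<in> L \<inter> cball 0 (R + 1)"
        by auto
      then show "\<exists>y\<in>(\<lambda>y. y + \<sigma> h) ` A h. dist y z < e"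
        using elim tri by blast
    qed
  qed
qed

text \<open>Sections parallel to the tangent hyperplane, projected along \<open>x\<close> instead of along the
  normal: in these coordinates the points that bound the lens on both sides, the multiples of
  \<open>x\<close>, have no horizontal component.\<close>

definition oblique_section :: "'a::euclidean_space set \<Rightarrow> 'a \<Rightarrow> 'a \<Rightarrow> real \<Rightarrow> 'a set" where
  "oblique_section K x u t =
     {y. y \<bullet> u = 0 \<and> x - (t / (x \<bullet> u)) *\<^sub>R x + sqrt (2 * t) *\<^sub>R y \<in> K}"

text \<open>At depth \<open>t\<close> the two projections differ by the fixed vector (t / s) x - t
  u, where s = x . u. Divided by sqrt (2 t) it is of order sqrt t, so it vanishes in the limit and
  both kinds of section have the same indicatrix.\<close>

lemma oblique_section_eq_scaled_section:
  assumes "norm u = 1" "x \<bullet> u > 0" "t > 0"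
  shows "oblique_section K x u t =
    (\<lambda>y. y + (sqrt (2 * t) / (2 * (x \<bullet> u))) *\<^sub>R (x - (x \<bullet> u) *\<^sub>R u)) ` scaled_section K x u t"
proof -
  define s where "s = x \<bullet> u"
  define r where "r = sqrt (2 * t)"
  have r: "r > 0" "r * r = 2 * t"
    using assms(3) by (auto simp: r_def)
  have s: "s > 0" "x \<bullet> u = s"
    using assms(2) by (simp_all add: s_def)
  have uu: "u \<bullet> u = 1"
    using assms(1) by (simp add: norm_eq_1)
  define \<sigma> where "\<sigma> = (r / (2 * s)) *\<^sub>R (x - s *\<^sub>R u)"
  have r\<sigma>: "r *\<^sub>R \<sigma> = (t / s) *\<^sub>R x - t *\<^sub>R u"
    using r(2) s(1) by (simp add: \<sigma>_def scaleR_diff_right)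
  have \<sigma>u: "\<sigma> \<bullet> u = 0"
    by (simp add: \<sigma>_def inner_diff_left s uu)
  have sec: "scaled_section K x u t =
     {(1 / r) *\<^sub>R (k - x + t *\<^sub>R u) | k. k \<in> K \<and> k \<bullet> u = s - t}"
    unfolding scaled_section_def r_def[symmetric] s(2)
    by (auto simp: inner_diff_left s(2) intro!: image_eqI exI)
  have "y \<in> oblique_section K x u t \<longleftrightarrow> y \<in> (\<lambda>y. y + \<sigma>) ` scaled_section K x u t" for y
  proof
    assume "y \<in> oblique_section K x u t"
    then have y: "y \<bullet> u = 0" "x - (t / s) *\<^sub>R x + r *\<^sub>R y \<in> K" (is "?k \<in> K")
      by (auto simp: oblique_section_def s(2) r_def)
    have "?k \<bullet> u = s - t"
      using y(1) s by (simp add: inner_diff_left inner_add_left)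
    moreover have "y = (1 / r) *\<^sub>R (?k - x + t *\<^sub>R u) + \<sigma>"
    proof -
      have "?k - x + t *\<^sub>R u = r *\<^sub>R (y - \<sigma>)"
        by (simp add: scaleR_diff_right r\<sigma>)
      then show ?thesis
        using r(1) by simp
    qed
    ultimately show "y \<in> (\<lambda>y. y + \<sigma>) ` scaled_section K x u t"
      unfolding sec using y(2) by blast
  next
    assume "y \<in> (\<lambda>y. y + \<sigma>) ` scaled_section K x u t"
    then obtain k where k: "k \<in> K" "k \<bullet> u = s - t" "y = (1 / r) *\<^sub>R (k - x + t *\<^sub>R u) + \<sigma>"
      unfolding sec by blast
    have "y \<bullet> u = 0"
      by (simp add: k(2,3) inner_add_left inner_diff_left \<sigma>u uu s(2))
    moreover have "x - (t / s) *\<^sub>R x + r *\<^sub>R y = k"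
      using r(1) by (simp add: k(3) scaleR_add_right r\<sigma>)
    ultimately show "y \<in> oblique_section K x u t"
      using k(1) by (simp add: oblique_section_def s(2) r_def)
  qed
  then show ?thesis
    unfolding \<sigma>_def r_def s_def by blast
qed

lemma oblique_section_converges:
  assumes "dupin_indicatrix_form K x u q" "norm u = 1" "x \<bullet> u > 0"
  shows "converges_locally (oblique_section K x u) {y \<in> {u}\<^sup>\<bottom>. q y \<le> 1} (at_right 0)"
proof -
  let ?\<sigma> = "\<lambda>t. (sqrt (2 * t) / (2 * (x \<bullet> u))) *\<^sub>R (x - (x \<bullet> u) *\<^sub>R u)"
  have "(?\<sigma> \<longlongrightarrow> (sqrt (2 * 0) / (2 * (x \<bullet> u))) *\<^sub>R (x - (x \<bullet> u) *\<^sub>R u)) (at_right 0)"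
    using assms(3) by (intro tendsto_intros) auto
  then have "(?\<sigma> \<longlongrightarrow> 0) (at_right 0)"
    by simp
  with assms(1) have "converges_locally (\<lambda>t. (\<lambda>y. y + ?\<sigma> t) ` scaled_section K x u t)
      {y \<in> {u}\<^sup>\<bottom>. q y \<le> 1} (at_right 0)"
    unfolding dupin_indicatrix_form_def by (intro converges_locally_translate) auto
  moreover have "\<forall>\<^sub>F t in at_right 0. oblique_section K x u t = (\<lambda>y. y + ?\<sigma> t) ` scaled_section K x u t"
    using eventually_at_right_less[of 0]
    by eventually_elim (rule oblique_section_eq_scaled_section[OF assms(2,3)])
  ultimately show ?thesis
    unfolding converges_locally_def[of "oblique_section K x u"]
  proof (intro allI impI, goal_cases)
    case (1 R e)
    from converges_locallyD[OF 1(1,3,4)] 1(2) show ?case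
      by eventually_elim (simp only:)
  qed
qed

section \<open>Solid paraboloids inside and outside the body\<close>

context
  fixes K :: "'a::euclidean_space set" and x u :: 'a and G :: "'a \<Rightarrow> 'a \<Rightarrow> real"
  assumes K: "closed K" "convex K" "x \<in> K" and xu: "x \<bullet> u > 0"
    and G: "bilinear G"
    and conv: "converges_locally (oblique_section K x u) {y. y \<bullet> u = 0 \<and> G y y \<le> 1} (at_right 0)"
begin

lemma continuous_on_form: "continuous_on A (\<lambda>y. G y y)"
  by (rule bilinear_continuous_on_compose[OF continuous_on_id continuous_on_id G])

lemma form_scale: "G (c *\<^sub>R y) (c *\<^sub>R y) = c\<^sup>2 * G y y"
  by (simp add: bilinear_lmul[OF G] bilinear_rmul[OF G] power2_eq_square)

text \<open>The set where G y y + \<epsilon> |y|^2 <= 1 is compact, even if \<open>G\<close> is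
  degenerate, and misses the closed set where G y y >= 1, so the two are some d > 0 apart. Points
  within d / 2 of the former satisfy G y y <= 1, hence are approximated by the section, and
  convexity puts the former set into the section.\<close>

lemma eventually_paraboloid_subset:
  assumes psd: "\<And>y. y \<bullet> u = 0 \<Longrightarrow> G y y \<ge> 0" and "\<epsilon> > 0"
  shows "\<forall>\<^sub>F t in at_right 0. \<forall>w. w \<bullet> u = 0 \<longrightarrow> G w w + \<epsilon> * (w \<bullet> w) \<le> 2 * t \<longrightarrow>
    x - (t / (x \<bullet> u)) *\<^sub>R x + w \<in> K"
proof -
  define S where "S = {y. y \<bullet> u = 0}"
  define E where "E = {y\<in>S. G y y + \<epsilon> * (y \<bullet> y) \<le> 1}"
  define U where "U = {y\<in>S. 1 \<le> G y y}"
  have S: "subspace S" "closed S"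
    using closed_hyperplane[of u 0] by (simp_all add: S_def subspace_def inner_add_left inner_commute[of u])
  have E_bound: "norm y \<le> sqrt (1 / \<epsilon>)" if "y \<in> E" for y
  proof -
    have "\<epsilon> * (y \<bullet> y) \<le> 1"
      using that psd[of y] by (simp add: E_def S_def)
    then show ?thesis
      using \<open>\<epsilon> > 0\<close> by (simp add: norm_eq_sqrt_inner field_simps)
  qed
  have "closed {y. G y y + \<epsilon> * (y \<bullet> y) \<le> 1}" "closed {y. 1 \<le> G y y}"
    by (intro closed_Collect_le continuous_intros continuous_on_form)+
  then have "closed E" "closed U"
    using S(2) unfolding E_def U_def Collect_conj_eq Collect_mem_eq by (auto intro: closed_Int)
  moreover have "bounded E"
    using E_bound by (auto simp: bounded_iff)
  moreover have "E \<inter> U = {}"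
  proof (rule ccontr)
    assume "E \<inter> U \<noteq> {}"
    then obtain y where y: "1 \<le> G y y" "G y y + \<epsilon> * (y \<bullet> y) \<le> 1"
      by (auto simp: E_def U_def)
    then have "\<epsilon> * (y \<bullet> y) \<le> 0"
      by linarith
    then have "y \<bullet> y \<le> 0"
      using \<open>\<epsilon> > 0\<close> by (simp add: mult_le_0_iff)
    then have "y = 0"
      by (metis inner_gt_zero_iff not_less)
    then show False
      using y bilinear_lzero[OF G] by simp
  qed
  ultimately obtain d where d: "d > 0" "\<And>y v. y \<in> E \<Longrightarrow> v \<in> U \<Longrightarrow> d \<le> dist y v"
    using separate_compact_closed[of E U] by (auto simp: compact_eq_bounded_closed)
  \<comment> \<open>The ball of this radius contains the d / 2 neighbourhood of \<open>E\<close>,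
    where local convergence is used.\<close>
  define R where "R = sqrt (1 / \<epsilon>) + d"
  have "R > 0"
    using d \<open>\<epsilon> > 0\<close> by (simp add: R_def add_nonneg_pos)
  have "\<forall>\<^sub>F t in at_right 0. \<forall>z\<in>{y. y \<bullet> u = 0 \<and> G y y \<le> 1} \<inter> cball 0 R.
      \<exists>y\<in>oblique_section K x u t. dist y z < d / 2"
    using converges_locallyD[OF conv \<open>R > 0\<close> half_gt_zero[OF d(1)]] by eventually_elim blast
  moreover have "\<forall>\<^sub>F t::real in at_right 0. t > 0"
    by (rule eventually_at_right_less)
  ultimately show ?thesis
  proof eventually_elim
    case (elim t)
    define r where "r = sqrt (2 * t)"
    have r: "r > 0" "r\<^sup>2 = 2 * t"
      using elim by (auto simp: r_def)
    have sec: "closed (oblique_section K x u t)" "convex (oblique_section K x u t)"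
      "oblique_section K x u t \<subseteq> S"
    proof -
      define p where "p = x - (t / (x \<bullet> u)) *\<^sub>R x"
      define g where "g y = p + r *\<^sub>R y" for y
      have eq: "oblique_section K x u t = S \<inter> g -` K"
        by (auto simp: oblique_section_def S_def g_def p_def r_def)
      have "continuous_on UNIV g"
        unfolding g_def by (intro continuous_intros)
      then show "closed (oblique_section K x u t)"
        unfolding eq using S K(1) by (intro closed_Int closed_vimage)
      show "convex (oblique_section K x u t)"
      proof (rule convexI)
        fix y z a b assume y: "y \<in> oblique_section K x u t" and z: "z \<in> oblique_section K x u t"
          and ab: "0 \<le> a" "0 \<le> b" "a + b = (1::real)"
        have "g (a *\<^sub>R y + b *\<^sub>R z) = (a + b) *\<^sub>R p + r *\<^sub>R (a *\<^sub>R y + b *\<^sub>R z)"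
          by (simp add: g_def ab)
        also have "\<dots> = a *\<^sub>R g y + b *\<^sub>R g z"
          unfolding g_def by (simp add: algebra_simps)
        also have "\<dots> \<in> K"
          using y z ab by (intro convexD[OF K(2)]) (auto simp: eq)
        finally show "a *\<^sub>R y + b *\<^sub>R z \<in> oblique_section K x u t"
          using y z S(1) unfolding eq by (auto intro: subspace_add subspace_scale)
      qed
    qed (auto simp: oblique_section_def S_def)
    show ?case
    proof (intro allI impI)
      fix w assume w: "w \<bullet> u = 0" "G w w + \<epsilon> * (w \<bullet> w) \<le> 2 * t"
      define y where "y = (1 / r) *\<^sub>R w"
      have "G y y + \<epsilon> * (y \<bullet> y) = (1 / r)\<^sup>2 * (G w w + \<epsilon> * (w \<bullet> w))"
        unfolding y_def form_scale by (simp add: power2_eq_square algebra_simps)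
      also have "\<dots> \<le> 1"
        using w(2) r elim by (simp add: power_divide)
      finally have y: "y \<in> E"
        using w(1) by (simp add: E_def S_def y_def)
      have "y \<in> oblique_section K x u t"
      proof (rule mem_closed_convex_of_nearby[OF sec S(1)])
        show "y \<in> S" "d / 2 > 0"
          using y d(1) by (auto simp: E_def)
        fix v assume v: "v \<in> S" "dist v y \<le> d / 2"
        have "v \<notin> U"
          using d(2)[OF y, of v] v(2) d(1) by (auto simp: dist_commute)
        then have "G v v \<le> 1"
          using v(1) by (simp add: U_def)
        moreover have "norm v \<le> R"
        proof -
          have "norm v \<le> norm y + dist v y"
            using norm_triangle_ineq2[of v y] by (simp add: dist_norm)
          then show ?thesis
            using E_bound[OF y] v(2) d(1) by (simp add: R_def)
        qed
        ultimately show "\<exists>z\<in>oblique_section K x u t. dist z v < d / 2"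
          using v(1) elim(1) by (auto simp: S_def)
      qed
      then show "x - (t / (x \<bullet> u)) *\<^sub>R x + w \<in> K"
        using r by (simp add: oblique_section_def y_def r_def)
    qed
  qed
qed

lemma form_lower_bound:
  assumes pos: "\<And>y. y \<bullet> u = 0 \<Longrightarrow> y \<noteq> 0 \<Longrightarrow> G y y > 0"
  shows "\<exists>m>0. \<forall>y. y \<bullet> u = 0 \<longrightarrow> m * (norm y)\<^sup>2 \<le> G y y"
proof (cases "sphere 0 1 \<inter> {y. u \<bullet> y = 0} = {}")
  case True
  have "y = 0" if "y \<bullet> u = 0" for y
  proof (rule ccontr)
    assume "y \<noteq> 0"
    then have "(1 / norm y) *\<^sub>R y \<in> sphere 0 1 \<inter> {y. u \<bullet> y = 0}"
      using that by (simp add: inner_commute)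
    then show False
      using True by blast
  qed
  then show ?thesis
    by (intro exI[of _ 1]) (metis bilinear_lzero[OF G] norm_zero mult_zero_right order_refl power_zero_numeral zero_less_one)
next
  case False
  have "compact (sphere 0 1 \<inter> {y. u \<bullet> y = 0})"
    by (intro compact_Int_closed closed_hyperplane) auto
  then obtain b where b: "norm b = 1" "b \<bullet> u = 0" and min: "\<And>y. norm y = 1 \<Longrightarrow> y \<bullet> u = 0 \<Longrightarrow> G b b \<le> G y y"
    using continuous_attains_inf[OF _ False continuous_on_form] by (auto simp: inner_commute)
  have "G b b * (norm y)\<^sup>2 \<le> G y y" if "y \<bullet> u = 0" for y
  proof (cases "y = 0")
    case False
    then have "G b b \<le> (1 / norm y)\<^sup>2 * G y y"
      unfolding form_scale[symmetric] using that by (intro min) auto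
    then show ?thesis
      using False by (simp add: power_divide pos_le_divide_eq)
  qed (simp add: bilinear_lzero[OF G])
  moreover have "G b b > 0"
    using b by (intro pos) auto
  ultimately show ?thesis
    by blast
qed

text \<open>Local convergence controls bounded sets only, so only the compact surface (1 -
  \<epsilon>) G y y = 1 is tested: it has positive distance from the indicatrix, so sections of
  small depth avoid it. By convexity a violating point farther out would produce a section point on
  that surface.\<close>

lemma eventually_subset_paraboloid:
  assumes pos: "\<And>y. y \<bullet> u = 0 \<Longrightarrow> y \<noteq> 0 \<Longrightarrow> G y y > 0" and "0 \<in> K" and \<epsilon>: "0 < \<epsilon>" "\<epsilon> < 1"
  shows "\<forall>\<^sub>F t in at_right 0. \<forall>w. w \<bullet> u = 0 \<longrightarrow> x - (t / (x \<bullet> u)) *\<^sub>R x + w \<in> K \<longrightarrow>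
    (1 - \<epsilon>) * G w w \<le> 2 * t"
proof -
  define S where "S = {y. y \<bullet> u = 0}"
  define E where "E = {y\<in>S. (1 - \<epsilon>) * G y y = 1}"
  define L where "L = {y\<in>S. G y y \<le> 1}"
  have S: "closed S"
    using closed_hyperplane[of u 0] by (simp add: S_def inner_commute)
  obtain m where m: "m > 0" "\<And>y. y \<in> S \<Longrightarrow> m * (norm y)\<^sup>2 \<le> G y y"
    using form_lower_bound[OF pos] by (auto simp: S_def)
  define R where "R = sqrt (1 / ((1 - \<epsilon>) * m))"
  have R: "R > 0"
    using m \<epsilon> by (simp add: R_def)
  have E_bound: "norm y \<le> R" if "y \<in> E" for y
  proof -
    have "(1 - \<epsilon>) * (m * (norm y)\<^sup>2) \<le> (1 - \<epsilon>) * G y y"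
      using that m(2) \<epsilon> by (intro mult_left_mono) (auto simp: E_def)
    also have "\<dots> = 1"
      using that by (simp add: E_def)
    finally have "(norm y)\<^sup>2 \<le> 1 / ((1 - \<epsilon>) * m)"
      using m(1) \<epsilon> by (simp add: field_simps)
    then show ?thesis
      unfolding R_def by (rule real_le_rsqrt)
  qed
  have "closed {y. (1 - \<epsilon>) * G y y = 1}" "closed {y. G y y \<le> 1}"
    by (intro closed_Collect_le closed_Collect_eq continuous_intros continuous_on_form)+
  then have "closed E" "closed L"
    using S unfolding E_def L_def Collect_conj_eq Collect_mem_eq by (auto intro: closed_Int)
  moreover have "bounded E"
    using E_bound by (auto simp: bounded_iff)
  moreover have "E \<inter> L = {}"
  proof (rule ccontr)
    assume "E \<inter> L \<noteq> {}"
    then obtain y where y: "(1 - \<epsilon>) * G y y = 1" "G y y \<le> 1"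
      by (auto simp: E_def L_def)
    then have "(1 - \<epsilon>) * G y y \<le> (1 - \<epsilon>) * 1"
      using \<epsilon> by (intro mult_left_mono) auto
    then show False
      using y \<epsilon> by simp
  qed
  ultimately obtain d where d: "d > 0" "\<And>y v. y \<in> E \<Longrightarrow> v \<in> L \<Longrightarrow> d \<le> dist y v"
    using separate_compact_closed[of E L] by (auto simp: compact_eq_bounded_closed)
  have "\<forall>\<^sub>F t in at_right 0. \<forall>y\<in>oblique_section K x u t \<inter> cball 0 R. \<exists>z\<in>L. dist y z < d"
    using converges_locallyD[OF conv R d(1)] unfolding L_def S_def by eventually_elim simp
  moreover have "\<forall>\<^sub>F t::real in at_right 0. t > 0"
    by (rule eventually_at_right_less)
  moreover have "\<forall>\<^sub>F t::real in at_right 0. t < x \<bullet> u"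
    using xu by (intro eventually_at_right_real[THEN eventually_mono]) auto
  ultimately show ?thesis
  proof eventually_elim
    case (elim t)
    define r where "r = sqrt (2 * t)"
    have r: "r > 0" "r\<^sup>2 = 2 * t"
      using elim by (auto simp: r_def)
    have base: "x - (t / (x \<bullet> u)) *\<^sub>R x \<in> K"
    proof -
      have "(1 - t / (x \<bullet> u)) *\<^sub>R x + (t / (x \<bullet> u)) *\<^sub>R 0 \<in> K"
        using elim xu K(3) \<open>0 \<in> K\<close> by (intro convexD[OF K(2)]) auto
      then show ?thesis
        by (simp add: scaleR_diff_left)
    qed
    show ?case
    proof (intro allI impI, rule ccontr)
      fix w assume w: "w \<bullet> u = 0" "x - (t / (x \<bullet> u)) *\<^sub>R x + w \<in> K" "\<not> (1 - \<epsilon>) * G w w \<le> 2 * t"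
      define c where "c = (1 - \<epsilon>) * G w w"
      \<comment> \<open>Contracting \<open>w\<close> by \<open>a\<close> places it, after rescaling
        by sqrt (2 t), exactly on \<open>E\<close>. The violated bound gives
        \<open>a \<le> 1\<close>, so the contracted point stays on a segment between two points of
        \<open>K\<close>.\<close>
      define a where "a = r / sqrt c"
      have c: "c > 2 * t" "c > 0"
        using w(3) elim by (auto simp: c_def)
      have a: "0 \<le> a" "a \<le> 1"
        using c r(1) by (auto simp: a_def r_def)
      define y where "y = (1 / sqrt c) *\<^sub>R w"
      have ry: "r *\<^sub>R y = a *\<^sub>R w"
        by (simp add: y_def a_def)
      have "(1 - a) *\<^sub>R (x - (t / (x \<bullet> u)) *\<^sub>R x) + a *\<^sub>R (x - (t / (x \<bullet> u)) *\<^sub>R x + w) \<in> K"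
        using a base w(2) by (intro convexD[OF K(2)]) auto
      moreover have "(1 - a) *\<^sub>R p + a *\<^sub>R (p + w) = p + a *\<^sub>R w" for p
        by (simp add: algebra_simps)
      ultimately have "x - (t / (x \<bullet> u)) *\<^sub>R x + r *\<^sub>R y \<in> K"
        unfolding ry by simp
      then have "y \<in> oblique_section K x u t"
        using w(1) by (simp add: oblique_section_def r_def y_def)
      moreover have yE: "y \<in> E"
      proof -
        have "(1 - \<epsilon>) * G y y = (1 / sqrt c)\<^sup>2 * c"
          unfolding y_def form_scale c_def by simp
        also have "\<dots> = 1"
          using c by (simp add: power_divide)
        finally show ?thesis
          using w(1) by (simp add: E_def S_def y_def)
      qed
      ultimately obtain z where "z \<in> L" "dist y z < d"
        using elim(1) E_bound by force
      then show False
        using d(2)[OF yE] by fastforce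
    qed
  qed
qed

text \<open>Covers depth 0. Contracting \<open>x + w\<close> towards 0 by the factor 1 - t / s, with
  s = x . u, gives a point of \<open>K\<close> at depth t whose horizontal part is (1 - t / s) w;
  the bound there passes to the limit.\<close>

lemma subset_paraboloid_zero:
  assumes "0 \<in> K" "x + w \<in> K"
    and ev: "\<forall>\<^sub>F t in at_right 0. \<forall>w. w \<bullet> u = 0 \<longrightarrow> x - (t / (x \<bullet> u)) *\<^sub>R x + w \<in> K \<longrightarrow>
      c * G w w \<le> 2 * t"
    and w: "w \<bullet> u = 0"
  shows "c * G w w \<le> 0"
proof (rule tendsto_le)
  let ?s = "x \<bullet> u"
  have "\<forall>\<^sub>F t::real in at_right 0. t > 0"
    by (rule eventually_at_right_less)
  moreover have "\<forall>\<^sub>F t::real in at_right 0. t < ?s"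
    using xu by (intro eventually_at_right_real[THEN eventually_mono]) auto
  ultimately show "\<forall>\<^sub>F t in at_right 0. c * ((1 - t / ?s)\<^sup>2 * G w w) \<le> 2 * t"
    using ev
  proof eventually_elim
    case (elim t)
    have "(1 - t / ?s) *\<^sub>R (x + w) + (t / ?s) *\<^sub>R 0 \<in> K"
      using elim xu assms(1,2) by (intro convexD[OF K(2)]) auto
    then have "x - (t / ?s) *\<^sub>R x + (1 - t / ?s) *\<^sub>R w \<in> K"
      by (simp add: algebra_simps)
    then have "c * G ((1 - t / ?s) *\<^sub>R w) ((1 - t / ?s) *\<^sub>R w) \<le> 2 * t"
      using elim w by simp
    then show ?case
      by (simp only: form_scale)
  qed
  have "((\<lambda>t. c * ((1 - t / ?s)\<^sup>2 * G w w)) \<longlongrightarrow> c * ((1 - 0 / ?s)\<^sup>2 * G w w)) (at_right 0)"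
    using xu by (intro tendsto_intros) auto
  then show "((\<lambda>t. c * ((1 - t / ?s)\<^sup>2 * G w w)) \<longlongrightarrow> c * G w w) (at_right 0)"
    by simp
  have "((\<lambda>t::real. 2 * t) \<longlongrightarrow> 2 * 0) (at_right 0)"
    by (intro tendsto_intros)
  then show "((\<lambda>t::real. 2 * t) \<longlongrightarrow> 0) (at_right 0)"
    by simp
qed simp

end

section \<open>Lens centres and the squeeze\<close>

lemma symmetric_convex_bodyD:
  assumes "symmetric_convex_body K"
  shows "compact K" "convex K" "0 \<in> interior K" "- y \<in> K \<longleftrightarrow> y \<in> K"
proof -
  show *: "compact K" "convex K"
    using assms by (auto simp: symmetric_convex_body_def)
  have neg: "uminus ` K = K" and "interior K \<noteq> {}"
    using assms by (auto simp: symmetric_convex_body_def)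
  then obtain z where z: "z \<in> interior K"
    by blast
  then have "- z \<in> interior K"
    using interior_negations[of K] neg by auto
  with z have "(1 / 2) *\<^sub>R z + (1 / 2) *\<^sub>R (- z) \<in> interior K"
    by (intro convexD[OF convex_interior[OF *(2)]]) auto
  then show "0 \<in> interior K"
    by simp
  show "- y \<in> K \<longleftrightarrow> y \<in> K"
    using neg by (metis image_eqI minus_minus)
qed

lemma outer_unit_normal_inner_pos:
  assumes "outer_unit_normal K x u" "0 \<in> interior K"
  shows "x \<bullet> u > 0"
proof -
  obtain r where r: "r > 0" "cball 0 r \<subseteq> K"
    using assms(2) by (auto simp: mem_interior_cball)
  have u: "norm u = 1" "\<And>y. y \<in> K \<Longrightarrow> (y - x) \<bullet> u \<le> 0"
    using assms(1) by (auto simp: outer_unit_normal_def)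
  have "r *\<^sub>R u \<in> K"
    using r u(1) by auto
  from u(2)[OF this] show ?thesis
    using r(1) u(1) by (simp add: inner_diff_left norm_eq_1)
qed

lemma width_eq:
  assumes "a \<in> A" "b \<in> A" "\<And>y. y \<in> A \<Longrightarrow> b \<bullet> u \<le> y \<bullet> u \<and> y \<bullet> u \<le> a \<bullet> u"
  shows "width u A = a \<bullet> u - b \<bullet> u"
proof -
  have "(SUP a\<in>A. a \<bullet> u) = a \<bullet> u"
    using assms by (intro cSup_eq_maximum) auto
  moreover have "(INF a\<in>A. a \<bullet> u) = b \<bullet> u"
    using assms by (intro cInf_eq_minimum) auto
  ultimately show ?thesis
    by (simp add: width_def)
qed

lemma mem_lens_iff:
  assumes "\<tau> > 0"
  shows "p \<in> lens K \<tau> c \<longleftrightarrow> p \<in> K \<and> (1 / \<tau>) *\<^sub>R (p - c) \<in> K"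
proof -
  have "p = c + \<tau> *\<^sub>R ((1 / \<tau>) *\<^sub>R (p - c))"
    using assms by simp
  moreover have "(1 / \<tau>) *\<^sub>R (c + \<tau> *\<^sub>R a - c) = a" for a
    using assms by simp
  ultimately show ?thesis
    unfolding lens_def by (metis (no_types, lifting) Int_iff image_iff)
qed

text \<open>Heights over \<open>K\<close> are extreme at x and -x, so the extreme heights of the
  lens are attained on the line through \<open>x\<close>. For p = l x the lens normally reaches from
  (l - \<tau>) x to x. Otherwise the height range of one body lies within that of the other and the
  width is 2 \<tau> (x . u) or 2 (x . u), which the bounds on \<open>h\<close> rule out; for l > 1 +
  \<tau> the lens is empty.\<close>

lemma is_lens_centre_iff:
  assumes K: "symmetric_convex_body K" and "x \<in> K" and u: "outer_unit_normal K x u"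
    and "\<tau> > 0" and h: "0 < h" "h < 2 * (x \<bullet> u)" "h < 2 * \<tau> * (x \<bullet> u)"
  shows "is_lens_centre K x u \<tau> h p \<longleftrightarrow> p = (1 + \<tau> - h / (x \<bullet> u)) *\<^sub>R x"
proof -
  define s where "s = x \<bullet> u"
  have s: "s > 0"
    using outer_unit_normal_inner_pos[OF u symmetric_convex_bodyD(3)[OF K]] by (simp add: s_def)
  note h = h[folded s_def]
  have supp: "y \<bullet> u \<le> s" if "y \<in> K" for y
    using u that by (auto simp: outer_unit_normal_def inner_diff_left s_def)
  have supp': "- s \<le> y \<bullet> u" if "y \<in> K" for y
    using supp[of "- y"] that symmetric_convex_bodyD(4)[OF K, of y] by simp
  have mult: "c *\<^sub>R x \<in> K" if "\<bar>c\<bar> \<le> 1" for c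
  proof -
    have "((1 + c) / 2) *\<^sub>R x + ((1 - c) / 2) *\<^sub>R (- x) \<in> K"
      using that \<open>x \<in> K\<close> symmetric_convex_bodyD(4)[OF K, of x]
      by (intro convexD[OF symmetric_convex_bodyD(2)[OF K]]) (auto simp: field_simps)
    also have "((1 + c) / 2) *\<^sub>R x + ((1 - c) / 2) *\<^sub>R (- x) = ((1 + c) / 2 - (1 - c) / 2) *\<^sub>R x"
      by (simp only: scaleR_diff_left[of "(1 + c) / 2" "(1 - c) / 2"]) simp
    also have "(1 + c) / 2 - (1 - c) / 2 = c"
      by (simp add: field_simps)
    finally show ?thesis .
  qed
  have mem: "c *\<^sub>R x \<in> lens K \<tau> (l *\<^sub>R x)" if "\<bar>c\<bar> \<le> 1" "\<bar>c - l\<bar> \<le> \<tau>" for c l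
  proof -
    have "(1 / \<tau>) *\<^sub>R (c *\<^sub>R x - l *\<^sub>R x) = ((c - l) / \<tau>) *\<^sub>R x"
      by (simp add: scaleR_diff_left[symmetric])
    then show ?thesis
      using that \<open>\<tau> > 0\<close> by (simp add: mem_lens_iff mult)
  qed
  have bounds: "y \<bullet> u \<le> s" "- s \<le> y \<bullet> u" "(l - \<tau>) * s \<le> y \<bullet> u" "y \<bullet> u \<le> (l + \<tau>) * s"
    if "y \<in> lens K \<tau> (l *\<^sub>R x)" for y l
  proof -
    have y: "y \<in> K" "(1 / \<tau>) *\<^sub>R (y - l *\<^sub>R x) \<in> K"
      using that \<open>\<tau> > 0\<close> by (auto simp: mem_lens_iff)
    show "y \<bullet> u \<le> s" "- s \<le> y \<bullet> u"
      using supp supp' y(1) by auto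
    have "(y \<bullet> u - l * s) / \<tau> \<le> s" "- s \<le> (y \<bullet> u - l * s) / \<tau>"
      using supp[OF y(2)] supp'[OF y(2)] by (auto simp: inner_diff_left s_def)
    then show "(l - \<tau>) * s \<le> y \<bullet> u" "y \<bullet> u \<le> (l + \<tau>) * s"
      using \<open>\<tau> > 0\<close> by (auto simp: field_simps)
  qed
  have width: "width u (lens K \<tau> (l *\<^sub>R x)) = (1 + \<tau> - l) * s"
    if "\<bar>1 - l\<bar> \<le> \<tau>" "\<bar>l - \<tau>\<bar> \<le> 1" for l
  proof -
    have "width u (lens K \<tau> (l *\<^sub>R x)) = (1 *\<^sub>R x) \<bullet> u - ((l - \<tau>) *\<^sub>R x) \<bullet> u"
      using that \<open>\<tau> > 0\<close> bounds by (intro width_eq mem) (auto simp: s_def)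
    then show ?thesis
      by (simp add: s_def algebra_simps)
  qed
  show ?thesis
    unfolding s_def[symmetric]
  proof
    assume "is_lens_centre K x u \<tau> h p"
    then obtain l where l: "l > 0" "p = l *\<^sub>R x" "lens K \<tau> (l *\<^sub>R x) \<noteq> {}"
      "width u (lens K \<tau> (l *\<^sub>R x)) = h"
      by (auto simp: is_lens_centre_def)
    then obtain y where "y \<in> lens K \<tau> (l *\<^sub>R x)"
      by blast
    from bounds(1,3)[OF this] have "(l - \<tau>) * s \<le> 1 * s"
      by simp
    then have l_le: "l \<le> 1 + \<tau>"
      using s by simp
    consider "l < 1 - \<tau>" | "l < \<tau> - 1" | "\<bar>1 - l\<bar> \<le> \<tau>" "\<bar>l - \<tau>\<bar> \<le> 1"
      using l_le by linarith
    then show "p = (1 + \<tau> - h / s) *\<^sub>R x"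
    proof cases
      case 1
      have "width u (lens K \<tau> (l *\<^sub>R x)) = ((l + \<tau>) *\<^sub>R x) \<bullet> u - ((l - \<tau>) *\<^sub>R x) \<bullet> u"
        using 1 l(1) \<open>\<tau> > 0\<close> bounds by (intro width_eq mem) (auto simp: s_def)
      then have "h = 2 * \<tau> * s"
        using l(4) by (simp add: s_def algebra_simps)
      then show ?thesis
        using h by simp
    next
      case 2
      have "width u (lens K \<tau> (l *\<^sub>R x)) = (1 *\<^sub>R x) \<bullet> u - ((- 1) *\<^sub>R x) \<bullet> u"
        using 2 l(1) \<open>\<tau> > 0\<close> bounds by (intro width_eq mem) (auto simp: s_def)
      then have "h = 2 * s"
        using l(4) by (simp add: s_def)
      then show ?thesis
        using h by simp
    next
      case 3
      then have "h = (1 + \<tau> - l) * s"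
        using width l(4) by simp
      then show ?thesis
        using s l(2) by simp
    qed
  next
    assume p: "p = (1 + \<tau> - h / s) *\<^sub>R x"
    define l where "l = 1 + \<tau> - h / s"
    have hs: "0 < h / s" "h / s < 2" "h / s < 2 * \<tau>"
      using h s by (auto simp: field_simps)
    have l: "l > 0" "\<bar>1 - l\<bar> \<le> \<tau>" "\<bar>l - \<tau>\<bar> \<le> 1"
      using hs unfolding l_def by linarith+
    have "width u (lens K \<tau> (l *\<^sub>R x)) = h"
      using width[OF l(2,3)] s by (simp add: l_def)
    moreover have "lens K \<tau> (l *\<^sub>R x) \<noteq> {}"
      using mem[of 1 l] l(2) by auto
    ultimately show "is_lens_centre K x u \<tau> h p"
      using l(1) p unfolding is_lens_centre_def l_def by blast
  qed
qed

text \<open>The point of \<open>K\<close> that the second body moves to p is the negative of the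
  second point listed; symmetry removes the sign. Thus the far side of the lens is again a cap at
  \<open>x\<close>, of depth coordinate (h - t) / \<tau>, and the same local estimates serve both
  sides.\<close>

lemma mem_lens_oblique:
  assumes "\<tau> > 0" and sym: "\<And>y. - y \<in> K \<longleftrightarrow> y \<in> K"
  shows "x - (t / s) *\<^sub>R x + w \<in> lens K \<tau> ((1 + \<tau> - h / s) *\<^sub>R x) \<longleftrightarrow>
    x - (t / s) *\<^sub>R x + w \<in> K \<and> x - ((h - t) / \<tau> / s) *\<^sub>R x + (- 1 / \<tau>) *\<^sub>R w \<in> K"
proof -
  define a b where "a = t / s" and "b = h / s"
  have "(h - t) / \<tau> / s = (b - a) / \<tau>"
    by (simp add: a_def b_def diff_divide_distrib mult.commute)
  then have "x - ((h - t) / \<tau> / s) *\<^sub>R x + (- 1 / \<tau>) *\<^sub>R w = (1 - (b - a) / \<tau>) *\<^sub>R x - (1 / \<tau>) *\<^sub>R w"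
    by (simp add: scaleR_diff_left)
  moreover have "(1 / \<tau>) *\<^sub>R (x - a *\<^sub>R x + w - (1 + \<tau> - b) *\<^sub>R x) =
      - ((1 - (b - a) / \<tau>) *\<^sub>R x - (1 / \<tau>) *\<^sub>R w)"
  proof -
    have "x - a *\<^sub>R x + w - (1 + \<tau> - b) *\<^sub>R x = (b - a - \<tau>) *\<^sub>R x + w"
      by (simp add: algebra_simps)
    moreover have "(1 / \<tau>) * (b - a - \<tau>) = (b - a) / \<tau> - 1"
      using assms(1) by (simp add: field_simps)
    ultimately have "(1 / \<tau>) *\<^sub>R (x - a *\<^sub>R x + w - (1 + \<tau> - b) *\<^sub>R x) = ((b - a) / \<tau> - 1) *\<^sub>R x + (1 / \<tau>) *\<^sub>R w"
      by (simp only: scaleR_add_right scaleR_scaleR)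
    then show ?thesis
      by (simp add: scaleR_diff_left)
  qed
  ultimately show ?thesis
    using sym[of "(1 - (b - a) / \<tau>) *\<^sub>R x - (1 / \<tau>) *\<^sub>R w"]
    by (simp add: mem_lens_iff[OF assms(1)] a_def[symmetric] b_def[symmetric])
qed

section \<open>Inclusions between the lens and its paraboloid models\<close>

context
  fixes K :: "'a::euclidean_space set" and x u :: 'a and Q :: "'a \<Rightarrow> real" and \<tau> h t\<^sub>0 s :: real
  assumes sym: "\<And>y. - y \<in> K \<longleftrightarrow> y \<in> K" and \<tau>: "\<tau> > 0" and s: "x \<bullet> u = s" "s > 0"
    and Q: "\<And>c w. Q (c *\<^sub>R w) = c\<^sup>2 * Q w"
    and h: "h < t\<^sub>0" "h / \<tau> < t\<^sub>0"
begin

lemma scaled_reflection_le: "Q ((- 1 / \<tau>) *\<^sub>R w) \<le> 2 * ((h - t) / \<tau>) \<longleftrightarrow> Q w \<le> 2 * \<tau> * (h - t)"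
proof -
  have "Q ((- 1 / \<tau>) *\<^sub>R w) = Q w / (\<tau> * \<tau>)"
    unfolding Q by (simp add: power2_eq_square)
  moreover have "2 * ((h - t) / \<tau>) = 2 * \<tau> * (h - t) / (\<tau> * \<tau>)"
    using \<tau> by simp
  ultimately show ?thesis
    using \<tau> by (simp only: divide_le_cancel) simp
qed

lemma model_lens_subset_lens:
  assumes nonneg: "\<And>w. Q w \<ge> 0"
    and inner: "\<And>t w. 0 \<le> t \<Longrightarrow> t < t\<^sub>0 \<Longrightarrow> w \<bullet> u = 0 \<Longrightarrow> Q w \<le> 2 * t \<Longrightarrow> x - (t / s) *\<^sub>R x + w \<in> K"
  shows "{x - (t / s) *\<^sub>R x + w | t w. w \<bullet> u = 0 \<and> Q w \<le> 2 * t \<and> Q w \<le> 2 * \<tau> * (h - t)}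
    \<subseteq> lens K \<tau> ((1 + \<tau> - h / s) *\<^sub>R x)"
proof clarify
  fix t w assume w: "w \<bullet> u = 0" "Q w \<le> 2 * t" "Q w \<le> 2 * \<tau> * (h - t)"
  \<comment> \<open>Nonnegativity of \<open>Q\<close> confines \<open>t\<close> to [0, h], so both
    depths t and (h - t) / \<tau> stay below \<open>t\<^sub>0\<close>.\<close>
  have "t \<ge> 0" "2 * \<tau> * (h - t) \<ge> 0"
    using w nonneg[of w] by linarith+
  then have t: "0 \<le> t" "t \<le> h"
    using \<tau> by (auto simp: zero_le_mult_iff)
  have "x - (t / s) *\<^sub>R x + w \<in> K"
    using t h w by (intro inner) auto
  moreover have "x - ((h - t) / \<tau> / s) *\<^sub>R x + (- 1 / \<tau>) *\<^sub>R w \<in> K"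
  proof (rule inner)
    show "Q ((- 1 / \<tau>) *\<^sub>R w) \<le> 2 * ((h - t) / \<tau>)"
      using w by (simp only: scaled_reflection_le)
    have "(h - t) / \<tau> \<le> h / \<tau>"
      using t \<tau> by (intro divide_right_mono) auto
    then show "(h - t) / \<tau> < t\<^sub>0"
      using h by linarith
  qed (use t \<tau> w in auto)
  ultimately show "x - (t / s) *\<^sub>R x + w \<in> lens K \<tau> ((1 + \<tau> - h / s) *\<^sub>R x)"
    by (simp only: mem_lens_oblique[OF \<tau> sym])
qed

lemma lens_subset_model_lens:
  assumes supp: "\<And>y. y \<in> K \<Longrightarrow> y \<bullet> u \<le> s"
    and outer: "\<And>t w. 0 \<le> t \<Longrightarrow> t < t\<^sub>0 \<Longrightarrow> w \<bullet> u = 0 \<Longrightarrow> x - (t / s) *\<^sub>R x + w \<in> K \<Longrightarrow> Q w \<le> 2 * t"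
  shows "lens K \<tau> ((1 + \<tau> - h / s) *\<^sub>R x) \<subseteq>
    {x - (t / s) *\<^sub>R x + w | t w. w \<bullet> u = 0 \<and> Q w \<le> 2 * t \<and> Q w \<le> 2 * \<tau> * (h - t)}"
proof
  fix p assume p: "p \<in> lens K \<tau> ((1 + \<tau> - h / s) *\<^sub>R x)"
  define t where "t = s - p \<bullet> u"
  define w where "w = p - x + (t / s) *\<^sub>R x"
  have w: "w \<bullet> u = 0"
    using s by (simp add: w_def t_def inner_diff_left inner_add_left)
  have pw: "p = x - (t / s) *\<^sub>R x + w"
    by (simp add: w_def)
  have 1: "x - (t / s) *\<^sub>R x + w \<in> K" and 2: "x - ((h - t) / \<tau> / s) *\<^sub>R x + (- 1 / \<tau>) *\<^sub>R w \<in> K"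
    using p unfolding pw mem_lens_oblique[OF \<tau> sym] by blast+
  \<comment> \<open>Here the range of \<open>t\<close> comes from the supporting hyperplane at
    \<open>x\<close>, applied to the point and to its reflected partner.\<close>
  have t: "0 \<le> t"
    using supp[OF 1] s w by (simp add: inner_diff_left inner_add_left)
  have t': "0 \<le> (h - t) / \<tau>"
    using supp[OF 2] s w by (simp add: inner_diff_left inner_add_left)
  have "t \<le> h"
    using t' \<tau> by (simp add: zero_le_divide_iff)
  then have "Q w \<le> 2 * t"
    using t h w 1 by (intro outer) auto
  moreover have "(h - t) / \<tau> \<le> h / \<tau>"
    using t \<tau> by (intro divide_right_mono) auto
  then have "(h - t) / \<tau> < t\<^sub>0"
    using h by linarith
  then have "Q ((- 1 / \<tau>) *\<^sub>R w) \<le> 2 * ((h - t) / \<tau>)"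
    using t' w 2 by (intro outer) auto
  then have "Q w \<le> 2 * \<tau> * (h - t)"
    by (simp only: scaled_reflection_le)
  ultimately show "p \<in> {x - (t / s) *\<^sub>R x + w | t w. w \<bullet> u = 0 \<and> Q w \<le> 2 * t \<and> Q w \<le> 2 * \<tau> * (h - t)}"
    using pw w by blast
qed

end

lemma lmeasurable_lens:
  assumes "compact K"
  shows "lens K \<tau> c \<in> lmeasurable"
proof -
  have "compact ((\<lambda>a. c + \<tau> *\<^sub>R a) ` K)"
    using assms by (intro compact_continuous_image continuous_intros)
  then show ?thesis
    unfolding lens_def using assms by (intro lmeasurable_compact compact_Int)
qed

section \<open>The constant and the exact quotient of a model\<close>

lemma sqrt_power_power2: "x \<ge> 0 \<Longrightarrow> (sqrt x ^ m)\<^sup>2 = x ^ m"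
  by (metis mult.commute power_mult real_sqrt_pow2)

text \<open>The origin of \<open>lens_const\<close>: the squared factor is the squared volume of the
  unit model. Since (1 + \<tau>) / \<tau> times 2 \<tau> / (1 + \<tau>) is 2, its dependence on
  \<tau> cancels, leaving 2^(n+1) times the square of the ball volume over n + 1.\<close>

lemma lens_const_power:
  fixes \<tau> :: real
  assumes "\<tau> > 0" "n \<ge> 1"
  shows "lens_const n ^ (n + 1) = ((1 + \<tau>) / \<tau>) ^ (n - 1) *
    (unit_ball_vol (real (n - 1)) * (2 * sqrt (2 * \<tau> / (1 + \<tau>)) ^ (n - 1) / (real (n - 1) + 2)))\<^sup>2"
proof -
  define m where "m = n - 1"
  have n: "n = m + 1" "real n + 1 = real m + 2"
    using assms(2) by (auto simp: m_def)
  define w where "w = unit_ball_vol (real m)"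
  have w: "w > 0"
    by (simp add: w_def)
  have "((w / (real m + 2)) powr (2 / (real m + 2))) ^ (m + 2) = (w / (real m + 2)) powr (real (m + 2) * (2 / (real m + 2)))"
    using w by (intro powr_power) auto
  also have "real (m + 2) * (2 / (real m + 2)) = 2"
    by (simp add: divide_simps)
  also have "(w / (real m + 2)) powr 2 = (w / (real m + 2))\<^sup>2"
    using w by simp
  finally have lhs: "lens_const n ^ (n + 1) = 2 ^ (m + 2) * (w / (real m + 2))\<^sup>2"
    by (simp add: lens_const_def n w_def power_mult_distrib add.commute)
  have "(sqrt (2 * \<tau> / (1 + \<tau>)) ^ m)\<^sup>2 = (2 * \<tau> / (1 + \<tau>)) ^ m"
    using assms(1) by (intro sqrt_power_power2) simp
  then have "((1 + \<tau>) / \<tau>) ^ m * (w * (2 * sqrt (2 * \<tau> / (1 + \<tau>)) ^ m / (real m + 2)))\<^sup>2 =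
      ((1 + \<tau>) / \<tau>) ^ m * (2 * \<tau> / (1 + \<tau>)) ^ m * (4 * (w / (real m + 2))\<^sup>2)"
    by (simp add: power_mult_distrib power_divide)
  also have "((1 + \<tau>) / \<tau>) ^ m * (2 * \<tau> / (1 + \<tau>)) ^ m = 2 ^ m"
  proof -
    have "d / \<tau> * (2 * \<tau> / d) = 2" if "d \<noteq> 0" for d
      using assms(1) that by simp
    from this[of "1 + \<tau>"] have "(1 + \<tau>) / \<tau> * (2 * \<tau> / (1 + \<tau>)) = 2"
      using assms(1) by linarith
    then show ?thesis
      by (simp only: power_mult_distrib[symmetric])
  qed
  finally show ?thesis
    unfolding lhs m_def[symmetric] w_def[symmetric] by simp
qed

text \<open>Used with \<open>a\<close> the volume of the unit model and \<open>P\<close> the product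
  of the eigenvalues. The powers of \<open>h\<close> cancel exactly, so no limit has to be taken on
  the model side.\<close>

lemma model_ratio:
  fixes a h \<rho> P :: real
  assumes "h > 0" "\<rho> > 0" "a > 0" "P > 0" and v: "v = a * (h * sqrt h ^ m / sqrt P)"
  shows "v > 0" "\<rho> ^ m * a\<^sup>2 * h ^ (m + 2) / (\<rho> ^ m * v\<^sup>2) = P"
proof -
  show "v > 0"
    using assms by simp
  have "v\<^sup>2 = a\<^sup>2 * (h\<^sup>2 * (sqrt h ^ m)\<^sup>2 / P)"
    using \<open>P > 0\<close> unfolding v by (simp add: power_mult_distrib power_divide)
  also have "(sqrt h ^ m)\<^sup>2 = h ^ m"
    using \<open>h > 0\<close> by (intro sqrt_power_power2) simp
  finally have "\<rho> ^ m * v\<^sup>2 = \<rho> ^ m * a\<^sup>2 * h ^ (m + 2) / P"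
    by (simp add: power_add power2_eq_square)
  then show "\<rho> ^ m * a\<^sup>2 * h ^ (m + 2) / (\<rho> ^ m * v\<^sup>2) = P"
    using assms by simp
qed

lemma lens_centre_eq:
  assumes K: "symmetric_convex_body K" and "x \<in> K" and u: "outer_unit_normal K x u" and "\<tau> > 0"
  shows "\<forall>\<^sub>F h in at_right 0. (\<exists>!p. is_lens_centre K x u \<tau> h p) \<and>
    lens_centre K x u \<tau> h = (1 + \<tau> - h / (x \<bullet> u)) *\<^sub>R x"
proof -
  have s: "x \<bullet> u > 0"
    using outer_unit_normal_inner_pos[OF u symmetric_convex_bodyD(3)[OF K]] .
  have "\<forall>\<^sub>F h in at_right 0. h \<in> {0<..<min (2 * (x \<bullet> u)) (2 * \<tau> * (x \<bullet> u))}"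
    using s \<open>\<tau> > 0\<close> by (intro eventually_at_right_real) auto
  then show ?thesis
  proof eventually_elim
    case (elim h)
    then have "is_lens_centre K x u \<tau> h p \<longleftrightarrow> p = (1 + \<tau> - h / (x \<bullet> u)) *\<^sub>R x" for p
      by (intro is_lens_centre_iff[OF assms]) auto
    then show ?case
      by (simp add: lens_centre_def)
  qed
qed

section \<open>The limit of the curvature quotient\<close>

lemma dupin_form_bilinear:
  assumes "dupin_indicatrix_form K x u q"
  shows "\<exists>G. bilinear G \<and> (\<forall>v w. G v w = G w v) \<and> (\<forall>w. w \<bullet> u = 0 \<longrightarrow> q w = G w w \<and> G w w \<ge> 0)"
proof -
  have S: "w \<in> {u}\<^sup>\<bottom> \<longleftrightarrow> w \<bullet> u = 0" for w
    by (auto simp: orthogonal_comp_def orthogonal_def inner_commute)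
  obtain F :: "'a \<Rightarrow> 'a \<Rightarrow> real" where F: "bilinear F" "\<And>w. w \<bullet> u = 0 \<Longrightarrow> q w = F w w"
    and nonneg: "\<And>w. w \<bullet> u = 0 \<Longrightarrow> q w \<ge> 0"
    using assms unfolding dupin_indicatrix_form_def psd_quadratic_form_on_def Ball_def S by blast
  \<comment> \<open>The given bilinear form may be asymmetric; its symmetric part has the same
    values on the diagonal and admits an orthonormal eigenbasis.\<close>
  define G where "G v w = (F v w + F w v) / 2" for v w
  have "bilinear G"
    unfolding bilinear_def
  proof (intro conjI allI linearI)
    fix v w z :: 'a and c :: real
    note simps = bilinear_ladd[OF F(1)] bilinear_radd[OF F(1)] bilinear_lmul[OF F(1)] bilinear_rmul[OF F(1)]
    show "G v (w + z) = G v w + G v z" "G (w + z) v = G w v + G z v"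
      by (simp_all add: G_def simps add_divide_distrib)
    show "G v (c *\<^sub>R w) = c *\<^sub>R G v w" "G (c *\<^sub>R w) v = c *\<^sub>R G w v"
      by (simp_all add: G_def simps distrib_left[symmetric])
  qed
  moreover have "G v w = G w v" for v w
    by (simp add: G_def)
  ultimately show ?thesis
    using F(2) nonneg by (intro exI[of _ G]) (simp add: G_def)
qed

text \<open>Formulated with \<open>eigenvalue_product\<close> for any admissible \<open>q\<close>:
  two such forms can then be compared through their common limit before the description defining the
  curvature is known to be unique.\<close>

proposition curvature_limit:
  fixes K :: "(real ^ 'n) set" and x N :: "real ^ 'n" and \<tau> :: real
  assumes K: "symmetric_convex_body K" and "x \<in> K" and N: "outer_unit_normal K x N"
    and q: "dupin_indicatrix_form K x N q" and "\<tau> > 0"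
  shows "((\<lambda>h. lens_const CARD('n) ^ (CARD('n) + 1) * h ^ (CARD('n) + 1) /
           (((1 + \<tau>) / \<tau>) ^ (CARD('n) - 1) *
            (measure lebesgue (lens K \<tau> (lens_centre K x N \<tau> h)))\<^sup>2))
      \<longlongrightarrow> eigenvalue_product ({N}\<^sup>\<bottom>) q) (at_right 0)"
proof -
  note body = symmetric_convex_bodyD[OF K]
  define s where "s = x \<bullet> N"
  have s: "s > 0"
    using outer_unit_normal_inner_pos[OF N body(3)] by (simp add: s_def)
  have supp: "y \<bullet> N \<le> s" if "y \<in> K" for y
    using N that by (auto simp: outer_unit_normal_def inner_diff_left s_def)
  have normN: "norm N = 1"
    using N by (simp add: outer_unit_normal_def)
  have "closed K" "0 \<in> K"
    using body(1,3) interior_subset by (auto simp: compact_imp_closed)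
  define S where "S = {w. w \<bullet> N = 0}"
  have NS: "{N}\<^sup>\<bottom> = S"
    by (auto simp: S_def orthogonal_comp_def orthogonal_def inner_commute)
  have S: "subspace S"
    unfolding NS[symmetric] by (rule subspace_orthogonal_comp)
  obtain G where G0: "bilinear G" "\<forall>v w. G v w = G w v"
      "\<forall>w. w \<bullet> N = 0 \<longrightarrow> q w = G w w \<and> G w w \<ge> 0"
    using dupin_form_bilinear[OF q] by (elim exE conjE)
  have "q w = G w w" "G w w \<ge> 0" if "w \<in> S" for w
    using that G0(3) by (simp_all add: S_def)
  note G = G0(1) G0(2)[rule_format] this
  have "{w \<in> {N}\<^sup>\<bottom>. q w \<le> 1} = {w. w \<bullet> N = 0 \<and> G w w \<le> 1}"
    unfolding NS using G(3) by (auto simp: S_def)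
  then have conv: "converges_locally (oblique_section K x N) {w. w \<bullet> N = 0 \<and> G w w \<le> 1} (at_right 0)"
    using oblique_section_converges[OF q normN] s by (simp add: s_def)
  note ctx = \<open>closed K\<close> body(2) \<open>x \<in> K\<close> s[unfolded s_def] G(1) conv
  obtain B where B: "finite B" "pairwise orthogonal B" "\<And>b. b \<in> B \<Longrightarrow> norm b = 1" "span B = S"
    and eig: "\<And>b w. b \<in> B \<Longrightarrow> w \<in> S \<Longrightarrow> G b w = G b b * (b \<bullet> w)"
    using orthonormal_eigenbasis[OF G(1,2) S] by blast
  have BS: "b \<in> S" if "b \<in> B" for b
    using that B(4) span_base by blast
  define \<kappa> where "\<kappa> = (\<Prod>b\<in>B. G b b)"
  have \<kappa>: "eigenvalue_product ({N}\<^sup>\<bottom>) q = \<kappa>"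
    unfolding NS \<kappa>_def using G(1,2) S G(3) B eig by (rule eigenvalue_product_orthonormal)
  \<comment> \<open>In an eigenbasis of \<open>G\<close> both perturbations are diagonal, with
    eigenvalues \<open>G b b + \<epsilon>\<close> and \<open>(1 - \<epsilon>) * G b b\<close>, so
    each is a form \<open>Q \<nu>\<close> to which the model volume applies.\<close>
  define Q where "Q \<nu> w = (\<Sum>b\<in>B. \<nu> b * (w \<bullet> b)\<^sup>2)" for \<nu> :: "real^'n \<Rightarrow> real" and w
  have Q_scale: "Q \<nu> (c *\<^sub>R w) = c\<^sup>2 * Q \<nu> w" for \<nu> c w
    by (simp add: Q_def sum_distrib_left power_mult_distrib mult.left_commute)
  have expand: "w = (\<Sum>b\<in>B. (w \<bullet> b) *\<^sub>R b)" if "w \<in> S" for w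
    using orthonormal_basis_expand[OF B(2,3) _ B(1)] that B(4) by simp
  have GQ: "G w w = Q (\<lambda>b. G b b) w" if "w \<in> S" for w
  proof -
    have "linear (\<lambda>v. G v w)"
      using G(1) by (simp add: bilinear_def)
    from linear_sum[OF this, of "\<lambda>b. (w \<bullet> b) *\<^sub>R b" B]
    have "G (\<Sum>b\<in>B. (w \<bullet> b) *\<^sub>R b) w = (\<Sum>b\<in>B. (w \<bullet> b) * G b w)"
      by (simp add: bilinear_lmul[OF G(1)])
    also have "\<dots> = Q (\<lambda>b. G b b) w"
      unfolding Q_def
    proof (rule sum.cong)
      fix b assume "b \<in> B"
      from eig[OF this that] show "(w \<bullet> b) * G b w = G b b * (w \<bullet> b)\<^sup>2"
        by (simp add: power2_eq_square inner_commute)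
    qed simp
    finally show ?thesis
      using expand[OF that] by simp
  qed
  have normQ: "w \<bullet> w = Q (\<lambda>_. 1) w" if "w \<in> S" for w
  proof -
    have "w \<bullet> w = w \<bullet> (\<Sum>b\<in>B. (w \<bullet> b) *\<^sub>R b)"
      using expand[OF that] by simp
    then show ?thesis
      by (simp add: inner_sum_right Q_def power2_eq_square)
  qed
  define m where "m = CARD('n) - 1"
  have n: "CARD('n) = m + 1"
    by (simp add: m_def)
  define \<rho> where "\<rho> = (1 + \<tau>) / \<tau>"
  have \<rho>: "\<rho> > 0"
    using \<open>\<tau> > 0\<close> by (simp add: \<rho>_def)
  define a where "a = unit_ball_vol (real m) * (2 * sqrt (2 * \<tau> / (1 + \<tau>)) ^ m / (real m + 2))"
  have a: "a > 0"
    using \<open>\<tau> > 0\<close> by (simp add: a_def)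
  have const: "lens_const CARD('n) ^ (CARD('n) + 1) = \<rho> ^ m * a\<^sup>2"
    unfolding \<rho>_def a_def m_def using \<open>\<tau> > 0\<close> by (intro lens_const_power) (auto simp: Suc_le_eq)
  define V where "V h = measure lebesgue (lens K \<tau> ((1 + \<tau> - h / s) *\<^sub>R x))" for h
  define f where "f h = \<rho> ^ m * a\<^sup>2 * h ^ (m + 2) / (\<rho> ^ m * (V h)\<^sup>2)" for h
  define R where "R \<nu> h = {x - (t / s) *\<^sub>R x + w | t w. w \<bullet> N = 0 \<and> Q \<nu> w \<le> 2 * t \<and> Q \<nu> w \<le> 2 * \<tau> * (h - t)}"
    for \<nu> h
  have R: "R \<nu> h \<in> lmeasurable" "measure lebesgue (R \<nu> h) > 0"
      "\<rho> ^ m * a\<^sup>2 * h ^ (m + 2) / (\<rho> ^ m * (measure lebesgue (R \<nu> h))\<^sup>2) = (\<Prod>b\<in>B. \<nu> b)"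
    if "\<forall>b\<in>B. \<nu> b > 0" "h > 0" for \<nu> h
  proof -
    have *: "R \<nu> h \<in> lmeasurable \<and> measure lebesgue (R \<nu> h) = a * (h * sqrt h ^ m / sqrt (\<Prod>b\<in>B. \<nu> b))"
      unfolding R_def Q_def a_def m_def
      using normN s_def[symmetric] s \<open>h > 0\<close> \<open>\<tau> > 0\<close> B(1-3) B(4)[unfolded S_def] that(1)[rule_format]
      by (rule measure_model_lens)
    then show "R \<nu> h \<in> lmeasurable"
      by blast
    have "(\<Prod>b\<in>B. \<nu> b) > 0"
      using that by (intro prod_pos) auto
    from model_ratio[OF \<open>h > 0\<close> \<rho> a this conjunct2[OF *]]
    show "measure lebesgue (R \<nu> h) > 0"
      "\<rho> ^ m * a\<^sup>2 * h ^ (m + 2) / (\<rho> ^ m * (measure lebesgue (R \<nu> h))\<^sup>2) = (\<Prod>b\<in>B. \<nu> b)"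
      by blast+
  qed
  have small: "\<forall>\<^sub>F h in at_right 0. 0 < h \<and> h < t\<^sub>0 \<and> h / \<tau> < t\<^sub>0" if "t\<^sub>0 > 0" for t\<^sub>0
  proof -
    have "\<forall>\<^sub>F h in at_right 0. h \<in> {0<..<min t\<^sub>0 (\<tau> * t\<^sub>0)}"
      using that \<open>\<tau> > 0\<close> by (intro eventually_at_right_real) auto
    then show ?thesis
      by eventually_elim (use \<open>\<tau> > 0\<close> in \<open>auto simp: field_simps\<close>)
  qed
  \<comment> \<open>The volume stands in the denominator, so the inner model gives the upper bound.
    Positivity of \<open>V h\<close> is recorded for the lower bound, where the denominator
    \<open>V h\<close> is compared with a larger one.\<close>
  have upper: "\<forall>\<^sub>F h in at_right 0. V h > 0 \<and> f h \<le> (\<Prod>b\<in>B. G b b + \<epsilon>)" if "\<epsilon> > 0" for \<epsilon>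
  proof -
    define \<nu> where "\<nu> b = G b b + \<epsilon>" for b
    have \<nu>: "\<forall>b\<in>B. \<nu> b > 0"
      using G(4)[OF BS] \<open>\<epsilon> > 0\<close> by (simp add: \<nu>_def add_nonneg_pos)
    have Q\<nu>: "Q \<nu> w = G w w + \<epsilon> * (w \<bullet> w)" if "w \<in> S" for w
      unfolding GQ[OF that] normQ[OF that]
      by (simp add: Q_def \<nu>_def sum.distrib sum_distrib_left distrib_right)
    obtain t\<^sub>0 where t\<^sub>0: "t\<^sub>0 > 0" "\<And>t w. 0 < t \<Longrightarrow> t < t\<^sub>0 \<Longrightarrow> w \<in> S \<Longrightarrow> Q \<nu> w \<le> 2 * t \<Longrightarrow>
        x - (t / s) *\<^sub>R x + w \<in> K"
      using eventually_paraboloid_subset[OF ctx _ \<open>\<epsilon> > 0\<close>] G(4) Q\<nu>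
      unfolding eventually_at_right_field s_def[symmetric] S_def by auto
    \<comment> \<open>The choice of \<open>t\<^sub>0\<close> covers positive depths only. At depth 0
      the \<epsilon> term forces \<open>w = 0\<close>, and the point is \<open>x\<close>
      itself.\<close>
    have inner: "x - (t / s) *\<^sub>R x + w \<in> K" if "0 \<le> t" "t < t\<^sub>0" "w \<bullet> N = 0" "Q \<nu> w \<le> 2 * t" for t w
    proof (cases "t = 0")
      case True
      have "w \<in> S"
        using that by (simp add: S_def)
      then have "\<epsilon> * (w \<bullet> w) \<le> 0"
        using that(4) True Q\<nu> G(4)[of w] by simp
      then have "w \<bullet> w \<le> 0"
        using \<open>\<epsilon> > 0\<close> by (simp add: mult_le_0_iff)
      then have "w = 0"
        by (metis inner_gt_zero_iff not_less)
      then show ?thesis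
        using True \<open>x \<in> K\<close> by simp
    next
      case False
      then show ?thesis
        using that by (intro t\<^sub>0(2)) (auto simp: S_def)
    qed
    show ?thesis
      using small[OF t\<^sub>0(1)]
    proof eventually_elim
      case (elim h)
      then have h: "0 < h" "h < t\<^sub>0" "h / \<tau> < t\<^sub>0"
        by auto
      have "R \<nu> h \<subseteq> lens K \<tau> ((1 + \<tau> - h / s) *\<^sub>R x)"
        unfolding R_def
      proof (rule model_lens_subset_lens[where t\<^sub>0 = t\<^sub>0])
        show "Q \<nu> w \<ge> 0" for w
          unfolding Q_def using \<nu> by (intro sum_nonneg mult_nonneg_nonneg) (auto intro: less_imp_le)
      qed (use body(4) \<open>\<tau> > 0\<close> s s_def Q_scale h inner in auto)
      then have le: "measure lebesgue (R \<nu> h) \<le> V h"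
        unfolding V_def
        by (rule measure_mono_fmeasurable[OF _ fmeasurableD[OF R(1)[of \<nu> h, OF \<nu> h(1)]] lmeasurable_lens[OF body(1)]])
      have "f h \<le> (\<Prod>b\<in>B. \<nu> b)"
        unfolding R(3)[of \<nu> h, OF \<nu> h(1), symmetric] f_def
        using le R(2)[of \<nu> h, OF \<nu> h(1)] h(1) \<rho> a
        by (intro divide_left_mono mult_left_mono power_mono mult_pos_pos) auto
      then show ?case
        using le R(2)[of \<nu> h, OF \<nu> h(1)] by (simp add: \<nu>_def)
    qed
  qed
  \<comment> \<open>With a zero eigenvalue the outer model would be an unbounded cylinder, hence
    \<open>pos\<close>.\<close>
  have lower: "\<forall>\<^sub>F h in at_right 0. (\<Prod>b\<in>B. (1 - \<epsilon>) * G b b) \<le> f h"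
    if pos: "\<forall>b\<in>B. G b b > 0" and \<epsilon>: "0 < \<epsilon>" "\<epsilon> < 1" for \<epsilon>
  proof -
    define \<nu> where "\<nu> b = (1 - \<epsilon>) * G b b" for b
    have \<nu>: "\<forall>b\<in>B. \<nu> b > 0"
      using pos \<epsilon> by (simp add: \<nu>_def)
    have Q\<nu>: "Q \<nu> w = (1 - \<epsilon>) * G w w" if "w \<in> S" for w
      unfolding GQ[OF that] by (simp add: Q_def \<nu>_def sum_distrib_left mult.assoc)
    have G_pos: "G w w > 0" if "w \<in> S" "w \<noteq> 0" for w
    proof (rule ccontr)
      assume "\<not> G w w > 0"
      then have "Q (\<lambda>b. G b b) w = 0"
        using GQ[OF that(1)] G(4)[OF that(1)] by simp
      then have "\<forall>b\<in>B. G b b * (w \<bullet> b)\<^sup>2 = 0"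
        unfolding Q_def using B(1) pos by (subst (asm) sum_nonneg_eq_0_iff) (auto simp: less_imp_le)
      then have "\<forall>b\<in>B. w \<bullet> b = 0"
        using pos by force
      then have "w \<bullet> w = 0"
        using normQ[OF that(1)] by (simp add: Q_def)
      then show False
        using that(2) by simp
    qed
    have ev: "\<forall>\<^sub>F t in at_right 0. \<forall>w. w \<bullet> N = 0 \<longrightarrow> x - (t / (x \<bullet> N)) *\<^sub>R x + w \<in> K \<longrightarrow>
        (1 - \<epsilon>) * G w w \<le> 2 * t"
      using G_pos \<open>0 \<in> K\<close> \<epsilon> by (intro eventually_subset_paraboloid[OF ctx]) (auto simp: S_def)
    then obtain t\<^sub>0 where t\<^sub>0: "t\<^sub>0 > 0" "\<And>t w. 0 < t \<Longrightarrow> t < t\<^sub>0 \<Longrightarrow> w \<in> S \<Longrightarrow>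
        x - (t / s) *\<^sub>R x + w \<in> K \<Longrightarrow> Q \<nu> w \<le> 2 * t"
      using Q\<nu> unfolding eventually_at_right_field s_def[symmetric] S_def by auto
    have outer: "Q \<nu> w \<le> 2 * t" if "0 \<le> t" "t < t\<^sub>0" "w \<bullet> N = 0" "x - (t / s) *\<^sub>R x + w \<in> K" for t w
    proof (cases "t = 0")
      case True
      then have "(1 - \<epsilon>) * G w w \<le> 0"
        using that \<open>0 \<in> K\<close> by (intro subset_paraboloid_zero[OF ctx _ _ ev]) auto
      then show ?thesis
        using True that Q\<nu>[of w] by (simp add: S_def)
    next
      case False
      then show ?thesis
        using that by (intro t\<^sub>0(2)) (auto simp: S_def)
    qed
    show ?thesis
      using small[OF t\<^sub>0(1)] upper[OF zero_less_one]
    proof eventually_elim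
      case (elim h)
      then have h: "0 < h" "h < t\<^sub>0" "h / \<tau> < t\<^sub>0" "V h > 0"
        by auto
      have "lens K \<tau> ((1 + \<tau> - h / s) *\<^sub>R x) \<subseteq> R \<nu> h"
        unfolding R_def
        by (rule lens_subset_model_lens[where t\<^sub>0 = t\<^sub>0])
          (use body(4) \<open>\<tau> > 0\<close> s s_def Q_scale h supp outer in auto)
      then have le: "V h \<le> measure lebesgue (R \<nu> h)"
        unfolding V_def
        by (rule measure_mono_fmeasurable[OF _ fmeasurableD[OF lmeasurable_lens[OF body(1)]] R(1)[of \<nu> h, OF \<nu> h(1)]])
      have "(\<Prod>b\<in>B. \<nu> b) \<le> f h"
        unfolding R(3)[of \<nu> h, OF \<nu> h(1), symmetric] f_def
        using le h(1,4) R(2)[of \<nu> h, OF \<nu> h(1)] \<rho> a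
        by (intro divide_left_mono mult_left_mono power_mono mult_pos_pos) auto
      then show ?case
        by (simp add: \<nu>_def)
    qed
  qed
  have "(f \<longlongrightarrow> \<kappa>) (at_right 0)"
  proof (rule order_tendstoI)
    fix c assume "\<kappa> < c"
    \<comment> \<open>By continuity of the product in \<epsilon>, one fixed \<epsilon> already
      brings it below \<open>c\<close>; only then does \<open>h\<close> tend to 0.\<close>
    have "((\<lambda>\<epsilon>. \<Prod>b\<in>B. G b b + \<epsilon>) \<longlongrightarrow> (\<Prod>b\<in>B. G b b + 0)) (at_right 0)"
      by (intro tendsto_intros)
    then have "\<forall>\<^sub>F \<epsilon> in at_right 0. (\<Prod>b\<in>B. G b b + \<epsilon>) < c"
      using \<open>\<kappa> < c\<close> by (intro order_tendstoD) (auto simp: \<kappa>_def)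
    then have "\<forall>\<^sub>F \<epsilon> in at_right 0. (\<Prod>b\<in>B. G b b + \<epsilon>) < c \<and> 0 < \<epsilon>"
      using eventually_at_right_less by (rule eventually_conj)
    then obtain \<epsilon> where \<epsilon>: "\<epsilon> > 0" "(\<Prod>b\<in>B. G b b + \<epsilon>) < c"
      using eventually_happens'[OF trivial_limit_at_right_real] by blast
    show "\<forall>\<^sub>F h in at_right 0. f h < c"
      using upper[OF \<epsilon>(1)] by eventually_elim (use \<epsilon>(2) in linarith)
  next
    fix c assume c: "c < \<kappa>"
    show "\<forall>\<^sub>F h in at_right 0. c < f h"
    proof (cases "\<kappa> = 0")
      case True
      \<comment> \<open>A quotient of nonnegative quantities exceeds every negative
        \<open>c\<close>, so vanishing curvature calls for no outer model.\<close>
      show ?thesis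
        using eventually_at_right_less[of "0::real"]
      proof eventually_elim
        case (elim h)
        have "f h \<ge> 0"
          unfolding f_def using elim \<rho> by (intro divide_nonneg_nonneg mult_nonneg_nonneg) auto
        then show ?case
          using c True by linarith
      qed
    next
      case False
      have pos: "\<forall>b\<in>B. G b b > 0"
      proof
        fix b assume b: "b \<in> B"
        have "G b b \<noteq> 0"
          using False b B(1) by (auto simp: \<kappa>_def)
        then show "G b b > 0"
          using G(4)[OF BS[OF b]] by simp
      qed
      have "((\<lambda>\<epsilon>. \<Prod>b\<in>B. (1 - \<epsilon>) * G b b) \<longlongrightarrow> (\<Prod>b\<in>B. (1 - 0) * G b b)) (at_right 0)"
        by (intro tendsto_intros)
      then have "\<forall>\<^sub>F \<epsilon> in at_right 0. c < (\<Prod>b\<in>B. (1 - \<epsilon>) * G b b)"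
        using c by (intro order_tendstoD) (auto simp: \<kappa>_def)
      moreover have "\<forall>\<^sub>F \<epsilon> in at_right (0::real). \<epsilon> \<in> {0<..<1}"
        by (intro eventually_at_right_real) auto
      ultimately have "\<forall>\<^sub>F \<epsilon> in at_right 0. c < (\<Prod>b\<in>B. (1 - \<epsilon>) * G b b) \<and> \<epsilon> \<in> {0<..<1}"
        by (rule eventually_conj)
      then obtain \<epsilon> where \<epsilon>: "c < (\<Prod>b\<in>B. (1 - \<epsilon>) * G b b)" "0 < \<epsilon>" "\<epsilon> < 1"
        using eventually_happens'[OF trivial_limit_at_right_real] by fastforce
      show ?thesis
        using lower[OF pos \<epsilon>(2,3)] by eventually_elim (use \<epsilon>(1) in linarith)
    qed
  qed
  moreover have "\<forall>\<^sub>F h in at_right 0. f h = lens_const CARD('n) ^ (CARD('n) + 1) * h ^ (CARD('n) + 1) /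
      (((1 + \<tau>) / \<tau>) ^ (CARD('n) - 1) * (measure lebesgue (lens K \<tau> (lens_centre K x N \<tau> h)))\<^sup>2)"
    using lens_centre_eq[OF K \<open>x \<in> K\<close> N \<open>\<tau> > 0\<close>]
  proof eventually_elim
    case (elim h)
    then have "lens_centre K x N \<tau> h = (1 + \<tau> - h / s) *\<^sub>R x"
      by (simp add: s_def)
    then show ?case
      unfolding const by (simp add: f_def V_def n \<rho>_def)
  qed
  ultimately show ?thesis
    unfolding \<kappa> by (rule Lim_transform_eventually)
qed

theorem theorem3p1:
  fixes K :: "(real ^ 'n) set" and x N :: "real ^ 'n" and \<tau> :: real
  assumes "symmetric_convex_body K"
    and "normal_point K x"
    and "outer_unit_normal K x N"
    and "\<tau> > 0"
  shows "(\<forall>\<^sub>F h in at_right 0. \<exists>!p. is_lens_centre K x N \<tau> h p) \<and>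
    ((\<lambda>h. lens_const CARD('n) ^ (CARD('n) + 1) * h ^ (CARD('n) + 1) /
           (((1 + \<tau>) / \<tau>) ^ (CARD('n) - 1) *
            (measure lebesgue (lens K \<tau> (lens_centre K x N \<tau> h)))\<^sup>2))
      \<longlongrightarrow> gauss_kronecker_curvature K x) (at_right 0)"
proof -
  have "closed K"
    using symmetric_convex_bodyD(1)[OF assms(1)] by (rule compact_imp_closed)
  then have xK: "x \<in> K"
    using assms(2) frontier_subset_closed by (auto simp: normal_point_def)
  have uniq: "u = N" if "outer_unit_normal K x u" for u
    using assms(2,3) that by (auto simp: normal_point_def)
  obtain q where q: "dupin_indicatrix_form K x N q"
    using assms(2) uniq by (auto simp: normal_point_def)
  note lim = curvature_limit[OF assms(1) xK assms(3) _ assms(4)]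
  have "gauss_kronecker_curvature K x = eigenvalue_product ({N}\<^sup>\<bottom>) q"
    unfolding gauss_kronecker_curvature_def
  proof (rule the_equality)
    show "\<exists>u q'. outer_unit_normal K x u \<and> dupin_indicatrix_form K x u q' \<and>
        eigenvalue_product ({N}\<^sup>\<bottom>) q = eigenvalue_product ({u}\<^sup>\<bottom>) q'"
      using assms(3) q by blast
    fix c assume "\<exists>u q. outer_unit_normal K x u \<and> dupin_indicatrix_form K x u q \<and>
        c = eigenvalue_product ({u}\<^sup>\<bottom>) q"
    then obtain q' where q': "dupin_indicatrix_form K x N q'" "c = eigenvalue_product ({N}\<^sup>\<bottom>) q'"
      using uniq by blast
    show "c = eigenvalue_product ({N}\<^sup>\<bottom>) q"
      unfolding q'(2) by (rule tendsto_unique[OF trivial_limit_at_right_real lim[OF q'(1)] lim[OF q]])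
  qed
  moreover have "\<forall>\<^sub>F h in at_right 0. \<exists>!p. is_lens_centre K x N \<tau> h p"
    using lens_centre_eq[OF assms(1) xK assms(3,4)] by eventually_elim blast
  ultimately show ?thesis
    using lim[OF q] by simp
qed

end
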